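(* Let $\tau\in[0,1)$, $N\ge1$, and let $(A^p)^j_k$ be the Hermite coefficients given below. (i) For integers $p_1,p_2\ge0$, $$M^{\rm H,\mathbb C}_{p_1,p_2,N}=\frac1{1-\tau^2}\frac1{p_1+1}\sum_{n=N-1-(p_1+1)\vee p_2}^{N+(p_1+1)\vee p_2}\frac{n!}{(N-1)!}\Big[(A^{p_1+1})^n_{N-1}(A^{p_2})^n_N-\tau(A^{p_1+1})^n_N(A^{p_2})^n_{N-1}\Big].$$ (ii) For integers $p_1,p_2\ge0$ with $p_1+p_2\ge1$, $$M^{\rm H,\mathbb H}_{p_1,p_2,N}=\frac12M^{\rm H,\mathbb C}_{p_1,p_2,2N}+(1-\tau^2)\frac{p_1p_2}{p_1+p_2}M^{\rm H,\mathbb H}_{p_1-1,p_2-1,N}-\frac12\sum_{k=0}^{N-1}\sum_{n=2N-p_1\vee p_2}^{2N+p_1\vee p_2}\frac{n!}{(2N)!}\frac{(2N)!!}{(2k)!!}\Big[\frac{p_1}{p_1+p_2}(A^{p_1})^n_{2k}(A^{p_2})^n_{2N}+\frac{p_2}{p_1+p_2}(A^{p_1})^n_{2N}(A^{p_2})^n_{2k}\Big],$$ where the second term is interpreted as $0$ when $p_1p_2=0$.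
   Context: Let $dA=d^2z/\pi$ and $\omega^{\rm H}(z)=\exp(-\frac{|z|^2-\tau\operatorname{Re}z^2}{1-\tau^2})$. $M^{\rm H,\mathbb C}_{p_1,p_2,N}$ is $\mathbb E[\sum_{j=1}^Nz_j^{p_1}\bar z_j^{p_2}]$ under the density on $\mathbb C^N$ proportional to $\prod_{j<k}|z_j-z_k|^2\prod_j\omega^{\rm H}(z_j)dA(z_j)$; $M^{\rm H,\mathbb H}_{p_1,p_2,N}$ is the same expectation under the density proportional to $\prod_{j<k}|z_j-z_k|^2|z_j-\bar z_k|^2\prod_j|z_j-\bar z_j|^2\omega^{\rm H}(z_j)dA(z_j)$. $\mathcal I_p=\{-p,-p+2,\dots,p\}$. Hermite coefficients: $(A^p)^j_k=\tau^{\frac{p+k-j}2}\sum_{l=0}^{\lfloor p/2\rfloor}\frac{p!}{2^l\,l!(\frac{p-k+j}2-l)!}\binom{k}{\frac{p+k-j}2-l}$ if $j,k\ge0$ and $j-k\in\mathcal I_p$, and $(A^p)^j_k=0$ otherwise (in particular for $j<0$); here $\tau^0=1$, $\binom nk=0$ unless $0\le k\le n$, $1/n!=0$ for negative integers $n$. (These are the coefficients of $z^pp_k(z)=\sum_j(A^p)^j_kp_j(z)$ for $p_k(z)=(\tau/2)^{k/2}H_k(z/\sqrt{2\tau})$.) $a\vee b=\max\{a,b\}$; $(2m)!!=2^mm!$. *)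

theory Defs
  imports "HOL-Analysis.Analysis" "HOL-Probability.Probability"
begin

definition omegaH :: "real \<Rightarrow> complex \<Rightarrow> real" where
  "omegaH \<tau> z = exp (- ((cmod z)^2 - \<tau> * Re (z^2)) / (1 - \<tau>^2))"

text \<open>Configurations in C^N are functions nat => complex, restricted to {..<N};
  the reference measure is the product of Lebesgue measure on C. The factor 1/pi
  in dA cancels in the normalised expectation.\<close>
abbreviation confM :: "nat \<Rightarrow> (nat \<Rightarrow> complex) measure" where
  "confM N \<equiv> PiM {..<N} (\<lambda>_. lborel)"

definition densC :: "real \<Rightarrow> nat \<Rightarrow> (nat \<Rightarrow> complex) \<Rightarrow> real" where
  "densC \<tau> N z = (\<Prod>j<N. \<Prod>k\<in>{j<..<N}. (cmod (z j - z k))^2) * (\<Prod>j<N. omegaH \<tau> (z j))"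

definition densH :: "real \<Rightarrow> nat \<Rightarrow> (nat \<Rightarrow> complex) \<Rightarrow> real" where
  "densH \<tau> N z = (\<Prod>j<N. \<Prod>k\<in>{j<..<N}. (cmod (z j - z k))^2 * (cmod (z j - cnj (z k)))^2)
      * (\<Prod>j<N. (cmod (z j - cnj (z j)))^2 * omegaH \<tau> (z j))"

definition expect :: "nat \<Rightarrow> ((nat \<Rightarrow> complex) \<Rightarrow> real) \<Rightarrow> ((nat \<Rightarrow> complex) \<Rightarrow> complex) \<Rightarrow> complex" where
  "expect N w f = (\<integral>z. f z * complex_of_real (w z) \<partial>confM N) / complex_of_real (\<integral>z. w z \<partial>confM N)"

definition momentFn :: "nat \<Rightarrow> nat \<Rightarrow> nat \<Rightarrow> (nat \<Rightarrow> complex) \<Rightarrow> complex" where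
  "momentFn p1 p2 N z = (\<Sum>j<N. z j ^ p1 * cnj (z j) ^ p2)"

definition MC :: "real \<Rightarrow> nat \<Rightarrow> nat \<Rightarrow> nat \<Rightarrow> complex" where
  "MC \<tau> p1 p2 N = expect N (densC \<tau> N) (momentFn p1 p2 N)"

definition MH :: "real \<Rightarrow> nat \<Rightarrow> nat \<Rightarrow> nat \<Rightarrow> complex" where
  "MH \<tau> p1 p2 N = expect N (densH \<tau> N) (momentFn p1 p2 N)"

definition invfact :: "int \<Rightarrow> real" where
  "invfact n = (if n < 0 then 0 else 1 / fact (nat n))"

definition binomZ :: "int \<Rightarrow> int \<Rightarrow> real" where
  "binomZ k m = (if 0 \<le> m \<and> m \<le> k then real (nat k choose nat m) else 0)"

definition Acoef :: "real \<Rightarrow> nat \<Rightarrow> int \<Rightarrow> int \<Rightarrow> real" where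
  "Acoef \<tau> p j k =
     (if j \<ge> 0 \<and> k \<ge> 0 \<and> j - k \<in> {- int p + 2 * int i | i. i \<le> p} then
        \<tau> ^ nat ((int p + k - j) div 2) *
        (\<Sum>l\<le>p div 2. fact p / (2 ^ l * fact l) * invfact ((int p - k + j) div 2 - int l)
              * binomZ k ((int p + k - j) div 2 - int l))
      else 0)"

text \<open>n! for integer n (only used where n >= 0 matters; set to 0 otherwise).\<close>
definition factZ :: "int \<Rightarrow> real" where
  "factZ n = (if n < 0 then 0 else fact (nat n))"

end

theory Submission
  imports Defs "Jordan_Normal_Form.Determinant"
begin

text \<open>
  Put $\langle f, g\rangle = \int f(z)\, g(\bar z)\, \omega(z)\, dz$ for polynomials $f, g$. Gaussian integration by
  parts gives $\langle zf, g\rangle = \tau\langle f', g\rangle + \langle f, g'\rangle$ and its mirror image. Hence the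
  monic Hermite polynomials $p_{n+1} = zp_n - \tau p_n'$ are orthogonal with squared norms
  proportional to $n!$, and everything else is algebra with this pairing.

  Expanding the Vandermonde determinant over permutations, inserting $\sum_j F(z_j)$ multiplies every
  single term of the normalisation integral by the same factor. This factor is
  $\sum_k \langle z^{p_1}p_k, z^{p_2}p_k\rangle/\langle p_k, p_k\rangle$ in the complex case, and the analogous
  sum over the skew-orthogonal polynomials in the symplectic case.

  Both formulas then follow by telescoping. For (i) one writes $(P+1)z^Pp_k = (z^{P+1}p_k)' - kz^{P+1}p_{k-1}$
  and moves the derivative to the other side. For (ii) the even skew-orthogonal polynomials
  satisfy $q_{2k+2} = p_{2k+2} + (2k+2)q_{2k}$ and $zq_{2k} - (1+\tau)q_{2k}' = p_{2k+1}$.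
\<close>

hide_const (open) Module.smult

section \<open>Hermite polynomials and their pairing\<close>

text \<open>The pairing is bilinear: conj z is substituted in the second slot and no coefficient is
  conjugated, so every identity is polynomial algebra from the two shift rules. Eliminating B f g'
  between them leaves (1 - t^2) B f' g, the source of 1/(1 - tau^2) in (i); subtracting them gives
  the factor 1 - t of the symplectic norms.

  In (ii), commuting L past z^P costs a term with the factor P, and past z^Q one with the factor Q.
  Writing p = Lq in the left slot of <z^P p, z^Q p> with weight Q, and in the right slot with weight
  P, gives every such cost the factor PQ. Hence the quotients p1/(p1+p2) and p2/(p1+p2), and the
  term in which both exponents are lowered.

  The recursion for p_n contains no division by tau, so tau = 0, where p_n = z^n, is not
  exceptional.\<close>

fun herm :: "'a::field_char_0 \<Rightarrow> nat \<Rightarrow> 'a poly" where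
  "herm t 0 = 1"
| "herm t (Suc n) = pCons 0 (herm t n) - smult t (pderiv (herm t n))"

text \<open>The Appell property. At n = 0 the truncated index n - 1 carries the coefficient 0; the
  same device recurs below.\<close>

lemma pderiv_herm: "pderiv (herm t n) = smult (of_nat n) (herm t (n - 1))"
proof (induction n)
  case (Suc n)
  show ?case
  proof (cases n)
    case (Suc m)
    have "pderiv (herm t (Suc n)) = herm t n + pCons 0 (smult (of_nat n) (herm t (n - 1)))
            - smult t (smult (of_nat n) (pderiv (herm t (n - 1))))"
      unfolding herm.simps pderiv_diff pderiv_pCons pderiv_smult Suc.IH ..
    also have "\<dots> = herm t n + smult (of_nat n) (herm t (Suc m))"
      by (simp add: Suc algebra_simps smult_diff_right)
    also have "\<dots> = smult (of_nat (Suc n)) (herm t n)"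
      by (simp only: Suc[symmetric] of_nat_Suc smult_add_left smult_1_left)
    finally show ?thesis by simp
  qed (simp add: pderiv_pCons)
qed simp

lemma pCons_herm: "pCons 0 (herm t n) = herm t (Suc n) + smult (t * of_nat n) (herm t (n - 1))"
  by (simp add: pderiv_herm)

lemma smult_sum_right: "smult c (sum f A) = (\<Sum>i\<in>A. smult c (f i))"
  by (induction A rule: infinite_finite_induct) (auto simp: smult_add_right)

lemma monom_Suc_mult: "monom 1 (Suc p) * f = monom 1 p * pCons 0 f"
  by (metis monom_Suc mult_pCons_left mult_pCons_right smult_0_left add_0)

lemma pCons_monom_mult: "pCons 0 (monom 1 p * f) = monom 1 (Suc p) * f"
  by (simp add: monom_Suc)

lemma herm_degree_lead: "degree (herm t n) = n \<and> coeff (herm t n) n = 1"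
proof (induction n)
  case (Suc n)
  have d: "degree (smult t (pderiv (herm t n))) \<le> n"
    using Suc degree_smult_le[of t "pderiv (herm t n)"] by (simp add: degree_pderiv)
  have nz: "herm t n \<noteq> 0" using Suc by (metis coeff_0 zero_neq_one)
  have d2: "degree (pCons 0 (herm t n)) = Suc n" using Suc nz by simp
  have "degree (herm t (Suc n)) = Suc n"
    unfolding herm.simps diff_conv_add_uminus using d d2
    by (subst degree_add_eq_left) auto
  moreover have "coeff (smult t (pderiv (herm t n))) (Suc n) = 0"
    using d by (intro coeff_eq_0) simp
  ultimately show ?case using Suc by simp
qed simp

declare herm.simps(2) [simp del]

text \<open>All that is used of the integral: the shift rules are Gaussian integration by parts, and
  they reduce every pairing to B 1 1. Leaving h free avoids the constant pi sqrt (1 -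
  tau^2).\<close>

locale hermite_pairing =
  fixes t h :: "'a::field_char_0" and B :: "'a poly \<Rightarrow> 'a poly \<Rightarrow> 'a"
  assumes add_left: "B (f + f') g = B f g + B f' g"
    and add_right: "B f (g + g') = B f g + B f g'"
    and smult_left: "B (smult c f) g = c * B f g"
    and smult_right: "B f (smult c g) = c * B f g"
    and shift_left: "B (pCons 0 f) g = t * B (pderiv f) g + B f (pderiv g)"
    and shift_right: "B f (pCons 0 g) = t * B f (pderiv g) + B (pderiv f) g"
    and one_one: "B 1 1 = h"
begin

lemma zero_left [simp]: "B 0 g = 0" using smult_left[of 0 0 g] by simp
lemma zero_right [simp]: "B f 0 = 0" using smult_right[of f 0 0] by simp
lemma diff_left: "B (f - f') g = B f g - B f' g"
  using add_left[of f "smult (-1) f'" g] smult_left[of "-1" f' g] by simp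
lemma diff_right: "B f (g - g') = B f g - B f g'"
  using add_right[of f g "smult (-1) g'"] smult_right[of f "-1" g'] by simp
lemma sum_left: "B (sum f A) g = (\<Sum>i\<in>A. B (f i) g)"
  by (induction A rule: infinite_finite_induct) (auto simp: add_left)
lemma sum_right: "B f (sum g A) = (\<Sum>i\<in>A. B f (g i))"
  by (induction A rule: infinite_finite_induct) (auto simp: add_right)

lemmas bilin = add_left add_right diff_left diff_right smult_left smult_right

text \<open>z - t d/dz in one slot is adjoint to d/dz in the other, because the t-terms cancel.
  Orthogonality follows by lowering both indices until one of them is 0.\<close>

lemma herm_Suc_left: "B (herm t (Suc n)) g = B (herm t n) (pderiv g)"
  by (simp add: bilin shift_left herm.simps(2))

lemma herm_Suc_right: "B f (herm t (Suc n)) = B (pderiv f) (herm t n)"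
  by (simp add: bilin shift_right herm.simps(2))

lemma herm_orth: "B (herm t m) (herm t n) = (if m = n then h * fact n else 0)"
proof (induction m arbitrary: n)
  case 0
  then show ?case
    by (cases n) (simp_all add: one_one herm_Suc_right del: herm.simps(2))
next
  case (Suc m)
  then show ?case
    by (cases n) (auto simp: herm_Suc_left pderiv_herm smult_right pderiv_1 simp del: herm.simps(2))
qed

section \<open>Adjoint of the derivative and telescoping of the complex moments\<close>

lemma adjoint_left: "(1 - t\<^sup>2) * B (pderiv f) g = B f (pCons 0 g) - t * B (pCons 0 f) g"
  by (simp add: shift_left shift_right power2_eq_square algebra_simps)

lemma shift_diff: "B (pCons 0 f) g - B f (pCons 0 g) = (1 - t) * (B f (pderiv g) - B (pderiv f) g)"
  by (simp add: shift_left shift_right algebra_simps)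

text \<open>\<open>adjoint_left\<close> is expanded with z p_k = p_(k+1) + t k p_(k-1). The terms
  containing p_(k-1), with weights k t, k t^2 and k (1 - t^2), recombine to exactly k T (k -
  1).\<close>

lemma moment_step:
  fixes P Q :: nat
  defines "T \<equiv> (\<lambda>k. B (monom 1 (Suc P) * herm t k) (monom 1 Q * herm t (Suc k))
                  - t * B (monom 1 (Suc P) * herm t (Suc k)) (monom 1 Q * herm t k))"
  shows "(1 - t\<^sup>2) * of_nat (Suc P) * B (monom 1 P * herm t k) (monom 1 Q * herm t k)
           = T k - of_nat k * T (k - 1)"
proof -
  let ?f = "monom 1 (Suc P) * herm t k" and ?g = "monom 1 Q * herm t k"
  have 1: "pderiv ?f = smult (of_nat (Suc P)) (monom 1 P * herm t k)
      + smult (of_nat k) (monom 1 (Suc P) * herm t (k - 1))"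
    by (simp add: pderiv_mult pderiv_monom pderiv_herm del: herm.simps of_nat_Suc)
       (metis mult_smult_left smult_monom mult.right_neutral mult.commute)
  have 2: "pCons 0 ?g = monom 1 Q * herm t (Suc k) + smult (t * of_nat k) (monom 1 Q * herm t (k - 1))"
    unfolding pCons_monom_mult monom_Suc_mult pCons_herm by (simp add: algebra_simps)
  have 3: "pCons 0 ?f = monom 1 (Suc P) * herm t (Suc k)
        + smult (t * of_nat k) (monom 1 (Suc P) * herm t (k - 1))"
    unfolding pCons_monom_mult monom_Suc_mult[of "Suc P"] pCons_herm by (simp add: algebra_simps)
  show ?thesis
    using adjoint_left[of ?f ?g] unfolding 1 2 3 bilin T_def
    by (cases k) (simp_all add: algebra_simps power2_eq_square del: herm.simps)
qed

text \<open>Division by k! turns k T (k - 1) into T (k - 1) / (k - 1)!, so only the last boundary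
  term survives. It pairs neighbouring degrees, hence the indices N - 1 and N in (i).\<close>

lemma moment_telescope:
  fixes P Q :: nat
  shows "(1 - t\<^sup>2) * of_nat (Suc P) * (\<Sum>k<Suc N. B (monom 1 P * herm t k) (monom 1 Q * herm t k) / fact k)
     = (B (monom 1 (Suc P) * herm t N) (monom 1 Q * herm t (Suc N))
        - t * B (monom 1 (Suc P) * herm t (Suc N)) (monom 1 Q * herm t N)) / fact N"
proof (induction N)
  case 0
  show ?case using moment_step[of P 0 Q] by simp
next
  case (Suc N)
  let ?S = "\<lambda>k. B (monom 1 P * herm t k) (monom 1 Q * herm t k)"
  let ?T = "\<lambda>k. B (monom 1 (Suc P) * herm t k) (monom 1 Q * herm t (Suc k))
        - t * B (monom 1 (Suc P) * herm t (Suc k)) (monom 1 Q * herm t k)"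
  have f: "(fact (Suc N) :: 'a) = of_nat (Suc N) * fact N" by simp
  have "(1 - t\<^sup>2) * of_nat (Suc P) * (\<Sum>k<Suc (Suc N). ?S k / fact k)
      = ?T N / fact N + (1 - t\<^sup>2) * of_nat (Suc P) * ?S (Suc N) / fact (Suc N)"
    unfolding sum.lessThan_Suc[of _ "Suc N"] distrib_left Suc.IH by simp
  also have "(1 - t\<^sup>2) * of_nat (Suc P) * ?S (Suc N) = ?T (Suc N) - of_nat (Suc N) * ?T N"
    using moment_step[of P "Suc N" Q] by (simp only: diff_Suc_1)
  also have "?T N / fact N + (?T (Suc N) - of_nat (Suc N) * ?T N) / fact (Suc N)
      = ?T (Suc N) / fact (Suc N)"
  proof -
    have "a / fact N + (b - of_nat (Suc N) * a) / fact (Suc N) = b / fact (Suc N)" for a b :: 'a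
      unfolding f diff_divide_distrib by (simp del: of_nat_Suc)
    then show ?thesis .
  qed
  finally show ?case .
qed

section \<open>Insertions with the weight z^P conj(z)^Q (conj z - z) and their recursion\<close>

definition insertion :: "nat \<Rightarrow> nat \<Rightarrow> 'a poly \<Rightarrow> 'a poly \<Rightarrow> 'a" where
  "insertion P Q f g = B (monom 1 P * f) (monom 1 (Suc Q) * g) - B (monom 1 (Suc P) * f) (monom 1 Q * g)"

text \<open>With z^P and z^Q absorbed into the polynomials, \<open>shift_diff\<close> trades the
  factor conj z - z for derivatives.\<close>

lemma insertion_eq:
  "insertion P Q f g = (1 - t) * (B (pderiv (monom 1 P * f)) (monom 1 Q * g)
      - B (monom 1 P * f) (pderiv (monom 1 Q * g)))"
proof -
  have "b - a = (1 - t) * (d - c)" if "a - b = (1 - t) * (c - d)" for a b c d :: 'a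
  proof -
    have "b - a = - (a - b)" by simp
    also have "\<dots> = (1 - t) * (d - c)" unfolding that by (simp add: algebra_simps)
    finally show ?thesis .
  qed
  from this[OF shift_diff[of "monom 1 P * f" "monom 1 Q * g"]] show ?thesis
    unfolding insertion_def pCons_monom_mult .
qed

text \<open>The even skew-orthogonal polynomials $q$ satisfy $Lq = p$ with $L = z - (1+\tau)\partial$ and
  $p$ the odd Hermite polynomial of one degree more; the recursion behind (ii) uses only $p = Lq$.\<close>

definition raise :: "'a poly \<Rightarrow> 'a poly" where
  "raise f = pCons 0 f - smult (1 + t) (pderiv f)"

text \<open>The last summand is the commutator of \<open>raise\<close> with multiplication by z^P;
  such terms later produce the insertion with both exponents lowered.\<close>

lemma monom_mult_raise: "monom 1 P * raise f = pCons 0 (monom 1 P * f)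
   - smult (1 + t) (pderiv (monom 1 P * f)) + smult ((1 + t) * of_nat P) (monom 1 (P - 1) * f)"
proof -
  have "pderiv (monom 1 P * f) = monom 1 P * pderiv f + smult (of_nat P) (monom 1 (P - 1) * f)"
    by (simp add: pderiv_mult pderiv_monom)
       (metis mult_smult_left smult_monom mult.right_neutral mult.commute)
  then show ?thesis
    by (simp add: raise_def algebra_simps smult_add_right)
qed

text \<open>Pairing z F yields t F' on the left, so subtracting (1 + t) F' leaves F' with
  coefficient -1: the antisymmetric combination of \<open>insertion_eq\<close>. This is the reason
  for the constant 1 + t.\<close>

lemma raise_left: "B (monom 1 P * raise f) g = B (monom 1 P * f) (pderiv g)
    - B (pderiv (monom 1 P * f)) g + (1 + t) * of_nat P * B (monom 1 (P - 1) * f) g"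
  unfolding monom_mult_raise bilin shift_left by (simp add: algebra_simps)

lemma raise_right: "B f (monom 1 Q * raise g) = B (pderiv f) (monom 1 Q * g)
    - B f (pderiv (monom 1 Q * g)) + (1 + t) * of_nat Q * B f (monom 1 (Q - 1) * g)"
  unfolding monom_mult_raise bilin shift_right by (simp add: algebra_simps)

text \<open>X + Y is the antisymmetrised insertion up to the factor 1 - t. Each pairing on the right
  is plus or minus X or Y plus one commutator term u1, ..., u4, and these four are the pieces of the
  lowered insertion.\<close>

lemma insertion_raise:
  fixes q :: "'a poly" and P Q :: nat
  defines "p \<equiv> raise q"
  shows "of_nat (P + Q) * (insertion P Q p q - insertion P Q q p)
   = (1 - t) * (of_nat (P + Q) * B (monom 1 P * p) (monom 1 Q * p)
       - of_nat P * B (monom 1 P * q) (monom 1 Q * raise p)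
       - of_nat Q * B (monom 1 P * raise p) (monom 1 Q * q))
     + (1 - t\<^sup>2) * of_nat P * of_nat Q * (insertion (P - 1) (Q - 1) p q - insertion (P - 1) (Q - 1) q p)"
proof -
  define X where "X = B (monom 1 P * q) (pderiv (monom 1 Q * p)) - B (pderiv (monom 1 P * q)) (monom 1 Q * p)"
  define Y where "Y = B (pderiv (monom 1 P * p)) (monom 1 Q * q) - B (monom 1 P * p) (pderiv (monom 1 Q * q))"
  define u1 where "u1 = B (monom 1 P * p) (monom 1 (Q - 1) * q)"
  define u2 where "u2 = B (monom 1 (P - 1) * q) (monom 1 Q * p)"
  define u3 where "u3 = B (monom 1 P * q) (monom 1 (Q - 1) * p)"
  define u4 where "u4 = B (monom 1 (P - 1) * p) (monom 1 Q * q)"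
  define W where "W = B (monom 1 P * p) (monom 1 Q * p)"
  \<comment> \<open>p = \<open>raise q\<close> is used in the right slot only; E2 uses it in the
    left slot only.\<close>
  have E1: "W = Y + (1 + t) * of_nat Q * u1"
    unfolding W_def Y_def u1_def by (subst (2) p_def, subst raise_right) simp
  have E2: "W = X + (1 + t) * of_nat P * u2"
    unfolding W_def X_def u2_def by (subst p_def, subst raise_left) simp
  have E3: "B (monom 1 P * q) (monom 1 Q * raise p) = - X + (1 + t) * of_nat Q * u3"
    unfolding X_def u3_def by (subst raise_right) simp
  have E4: "B (monom 1 P * raise p) (monom 1 Q * q) = - Y + (1 + t) * of_nat P * u4"
    unfolding Y_def u4_def by (subst raise_left) simp
  have E5: "insertion P Q p q - insertion P Q q p = (1 - t) * (X + Y)"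
    unfolding insertion_eq X_def Y_def by (simp add: algebra_simps)
  \<comment> \<open>The factor P Q removes the cases P = 0 and Q = 0, in which P - 1 or Q - 1 is
    truncated.\<close>
  have E6: "of_nat P * of_nat Q * (insertion (P - 1) (Q - 1) p q - insertion (P - 1) (Q - 1) q p)
      = of_nat P * of_nat Q * (u4 - u1 - u2 + u3)"
    by (cases P; cases Q) (simp_all add: insertion_def u1_def u2_def u3_def u4_def)
  have "of_nat (P + Q) * W = of_nat P * (Y + (1 + t) * of_nat Q * u1) + of_nat Q * (X + (1 + t) * of_nat P * u2)"
    unfolding E1[symmetric] E2[symmetric] by (simp add: algebra_simps)
  moreover have "(1 - t\<^sup>2) * of_nat P * of_nat Q * (insertion (P - 1) (Q - 1) p q - insertion (P - 1) (Q - 1) q p)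
      = (1 - t\<^sup>2) * (of_nat P * of_nat Q * (u4 - u1 - u2 + u3))"
    unfolding E6[symmetric] by (simp only: mult.assoc)
  ultimately show ?thesis
    unfolding E3 E4 E5 W_def[symmetric]
    by (simp add: algebra_simps power2_eq_square)
qed

fun even_skew_poly :: "nat \<Rightarrow> 'a poly" where
  "even_skew_poly 0 = 1"
| "even_skew_poly (Suc k) = herm t (2 * k + 2) + smult (of_nat (2 * k + 2)) (even_skew_poly k)"

text \<open>\<open>raise\<close> sends p_(2k+2) to p_(2k+3) - (2k+2) p_(2k+1); the second summand in
  the recursion of \<open>even_skew_poly\<close> is there to cancel the unwanted term. The index k
  is half the degree.\<close>

lemma raise_even_skew_poly: "raise (even_skew_poly k) = herm t (2 * k + 1)"
proof (induction k)
  case 0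
  show ?case by (simp add: raise_def pderiv_1 herm.simps(2))
next
  case (Suc k)
  have "raise (even_skew_poly (Suc k)) = raise (herm t (2 * k + 2)) + smult (of_nat (2 * k + 2)) (raise (even_skew_poly k))"
    unfolding raise_def even_skew_poly.simps pderiv_add pderiv_smult by (simp add: algebra_simps smult_add_right smult_diff_right del: herm.simps)
  also have "raise (herm t (2 * k + 2)) = herm t (2 * k + 3) - smult (of_nat (2 * k + 2)) (herm t (2 * k + 1))"
    unfolding raise_def pderiv_herm pCons_herm
    by (simp add: algebra_simps smult_add_left smult_add_right eval_nat_numeral del: herm.simps)
  finally show ?case unfolding Suc.IH by (simp add: eval_nat_numeral del: herm.simps)
qed

lemma raise_herm: "raise (herm t (Suc n)) = herm t (n + 2) - smult (of_nat (Suc n)) (herm t n)"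
  unfolding raise_def pderiv_herm pCons_herm
  by (simp add: algebra_simps smult_add_left eval_nat_numeral del: herm.simps of_nat_Suc)

lemma even_skew_poly_degree_lead: "degree (even_skew_poly k) = 2 * k \<and> coeff (even_skew_poly k) (2 * k) = 1"
proof (induction k)
  case (Suc k)
  note H = herm_degree_lead[of t "2 * k + 2"]
  have d: "degree (smult (of_nat (2 * k + 2)) (even_skew_poly k)) < 2 * k + 2" using Suc
    by (metis degree_smult_le le_imp_less_Suc less_SucI add_2_eq_Suc')
  have "degree (even_skew_poly (Suc k)) = 2 * k + 2"
    unfolding even_skew_poly.simps using d H by (subst degree_add_eq_left) auto
  moreover have "coeff (even_skew_poly (Suc k)) (2 * k + 2) = 1"
    unfolding even_skew_poly.simps using d H by (simp only: coeff_add coeff_eq_0) simp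
  ultimately show ?case by simp
qed simp

text \<open>The unrolled recursion; 2^N N! / (2^k k!) is the quotient (2N)!!/(2k)!! of (ii). The top
  term p_(2N) is split off because the telescoped recursion ends with q_(2N) - p_(2N).\<close>

lemma even_skew_poly_sum: "(\<Sum>k<N. smult (2 ^ N * fact N / (2 ^ k * fact k)) (herm t (2 * k)))
   = even_skew_poly N - herm t (2 * N)"
proof (induction N)
  case (Suc N)
  have "(\<Sum>k<Suc N. smult (2 ^ Suc N * fact (Suc N) / (2 ^ k * fact k)) (herm t (2 * k)))
     = smult (of_nat (2 * N + 2)) (\<Sum>k<Suc N. smult (2 ^ N * fact N / (2 ^ k * fact k)) (herm t (2 * k)))"
    unfolding smult_sum_right smult_smult by (intro sum.cong refl arg_cong2[of _ _ _ _ smult]) (simp add: field_simps)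
  also have "(\<Sum>k<Suc N. smult (2 ^ N * fact N / (2 ^ k * fact k)) (herm t (2 * k))) = even_skew_poly N"
    unfolding sum.lessThan_Suc Suc.IH by simp
  finally show ?case by (simp del: herm.simps)
qed simp

text \<open>Half the antisymmetrised insertion of the k-th pair over its skew norm (1 - t) h
  (2k+1)!, with h left out. The odd polynomial stands first because \<open>insertion\<close> has the
  weight conj z - z and \<open>skew\<close> the opposite one.\<close>

definition symplectic_term :: "nat \<Rightarrow> nat \<Rightarrow> nat \<Rightarrow> 'a" where
  "symplectic_term P Q k = (insertion P Q (herm t (2 * k + 1)) (even_skew_poly k) - insertion P Q (even_skew_poly k) (herm t (2 * k + 1)))
     / (2 * (1 - t) * fact (2 * k + 1))"

text \<open>\<open>insertion_raise\<close> at q = q_(2k): its p is then a Hermite polynomial, so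
  \<open>raise p\<close> is explicit too and no further skew-orthogonal polynomial enters.\<close>

lemma symplectic_term_step:
  fixes P Q k :: nat
  defines "q \<equiv> even_skew_poly k" and "p \<equiv> herm t"
  assumes t: "t \<noteq> 1"
  shows "of_nat (P + Q) * symplectic_term P Q k = (of_nat (P + Q) * B (monom 1 P * p (2*k+1)) (monom 1 Q * p (2*k+1))
       - of_nat P * B (monom 1 P * q) (monom 1 Q * (p (2*k+2) - smult (of_nat (2*k+1)) (p (2*k))))
       - of_nat Q * B (monom 1 P * (p (2*k+2) - smult (of_nat (2*k+1)) (p (2*k)))) (monom 1 Q * q))
      / (2 * fact (2*k+1)) + (1 - t\<^sup>2) * of_nat P * of_nat Q * symplectic_term (P-1) (Q-1) k"
proof -
  have [simp]: "1 - t \<noteq> 0" using t by simp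
  have r: "raise (herm t (2*k+1)) = p (2*k+2) - smult (of_nat (2*k+1)) (p (2*k))"
    using raise_herm[of "2*k"] by (simp add: p_def del: herm.simps)
  define c :: 'a where "c = fact (2*k+1)"
  have c: "c \<noteq> 0" unfolding c_def by (rule fact_nonzero)
  have *: "(1-t) \<noteq> 0 \<Longrightarrow> X * d = (1-t) * A + Z * d' \<Longrightarrow> X * (d / (2*(1-t)*c)) = A / (2*c) + Z * (d' / (2*(1-t)*c))"
    for X d A Z d' :: 'a
  proof -
    assume a: "1 - t \<noteq> 0" "X * d = (1-t) * A + Z * d'"
    have "X * (d / (2*(1-t)*c)) = (X * d) / (2*(1-t)*c)" by simp
    moreover have "2*(1-t)*c = (1-t)*(2*c)" by simp
    moreover have "(1-t) * A / ((1-t)*(2*c)) = A / (2*c)" using a(1) by (rule mult_divide_mult_cancel_left)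
    ultimately show ?thesis unfolding a(2) by (simp only: add_divide_distrib times_divide_eq_right)
  qed
  note I = insertion_raise[of P Q q, unfolded q_def raise_even_skew_poly r[unfolded p_def], folded q_def p_def]
  have "1 - t \<noteq> 0" using t by simp
  from *[OF this I] show ?thesis
    unfolding symplectic_term_def c_def[symmetric] p_def q_def .
qed

text \<open>As q_(2k+2) = p_(2k+2) + (2k+2) q_(2k), the pairings of q_(2k) with p_(2k+2) at step k
  cancel those of q_(2k+2) with p_(2k+2) at step k + 1, up to a diagonal term of even degree. These
  even terms and the odd one of each step fill the complex sum over n < 2N. The diagonal term of
  p_(2N) lies outside it, hence q_(2N) - p_(2N) at the end.\<close>

lemma symplectic_term_telescope:
  fixes P Q :: nat
  assumes t: "t \<noteq> 1"
  shows "of_nat (P + Q) * (\<Sum>k<N. symplectic_term P Q k)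
    = of_nat (P + Q) / 2 * (\<Sum>n<2*N. B (monom 1 P * herm t n) (monom 1 Q * herm t n) / fact n)
    + (1 - t\<^sup>2) * of_nat P * of_nat Q * (\<Sum>k<N. symplectic_term (P-1) (Q-1) k)
    - (of_nat P * B (monom 1 P * (even_skew_poly N - herm t (2*N))) (monom 1 Q * herm t (2*N))
     + of_nat Q * B (monom 1 P * herm t (2*N)) (monom 1 Q * (even_skew_poly N - herm t (2*N)))) / (2 * fact (2*N))"
proof (induction N)
  case (Suc N)
  let ?p = "herm t"
  define D where "D = (\<lambda>n. B (monom 1 P * ?p n) (monom 1 Q * ?p n))"
  define a1 where "a1 = B (monom 1 P * even_skew_poly N) (monom 1 Q * ?p (2*N+2))"
  define a2 where "a2 = B (monom 1 P * even_skew_poly N) (monom 1 Q * ?p (2*N))"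
  define b1 where "b1 = B (monom 1 P * ?p (2*N+2)) (monom 1 Q * even_skew_poly N)"
  define b2 where "b2 = B (monom 1 P * ?p (2*N)) (monom 1 Q * even_skew_poly N)"
  define c :: 'a where "c = fact (2*N)"
  define n :: 'a where "n = of_nat (2*N+1)"
  have "n = of_nat (Suc (2*N))" "n + 1 = of_nat (Suc (Suc (2*N)))" by (simp_all add: n_def)
  then have c: "c \<noteq> 0" "n \<noteq> 0" "n + 1 \<noteq> 0"
    unfolding c_def by (simp_all only: fact_nonzero of_nat_neq_0 not_False_eq_True)
  have f1: "fact (2*N+1) = n * c" unfolding c_def n_def by simp
  have f2: "fact (2*Suc N) = (n + 1) * n * c" unfolding c_def n_def by (simp add: algebra_simps)
  have e: "even_skew_poly (Suc N) - ?p (2*Suc N) = smult (n + 1) (even_skew_poly N)"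
    unfolding n_def by (simp del: herm.simps)
  have step: "of_nat (P + Q) * symplectic_term P Q N = (of_nat (P + Q) * D (2*N+1)
       - of_nat P * (a1 - n * a2) - of_nat Q * (b1 - n * b2))
      / (2 * n * c) + (1 - t\<^sup>2) * of_nat P * of_nat Q * symplectic_term (P-1) (Q-1) N"
    using symplectic_term_step[OF t, of P Q N]
    unfolding f1 n_def[symmetric] D_def a1_def a2_def b1_def b2_def right_diff_distrib mult_smult_right bilin mult.assoc .
  have S: "(\<Sum>m<2*Suc N. D m / fact m) = (\<Sum>m<2*N. D m / fact m) + D (2*N) / c + D (2*N+1) / (n*c)"
  proof -
    have "2 * Suc N = Suc (Suc (2*N))" "2 * N + 1 = Suc (2 * N)" by simp_all
    then show ?thesis using f1 by (simp only: sum.lessThan_Suc c_def)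
  qed
  have IH: "of_nat (P + Q) * (\<Sum>k<N. symplectic_term P Q k)
    = of_nat (P + Q) / 2 * (\<Sum>m<2*N. D m / fact m)
    + (1 - t\<^sup>2) * of_nat P * of_nat Q * (\<Sum>k<N. symplectic_term (P-1) (Q-1) k)
    - (of_nat P * (a2 - D (2*N)) + of_nat Q * (b2 - D (2*N))) / (2 * c)"
    using Suc.IH unfolding a2_def b2_def D_def c_def right_diff_distrib bilin .
  have "of_nat (P + Q) * (\<Sum>k<Suc N. symplectic_term P Q k)
    = of_nat (P + Q) / 2 * (\<Sum>m<2*Suc N. D m / fact m)
    + (1 - t\<^sup>2) * of_nat P * of_nat Q * (\<Sum>k<Suc N. symplectic_term (P-1) (Q-1) k)
    - (of_nat P * ((n+1) * a1) + of_nat Q * ((n+1) * b1)) / (2 * ((n + 1) * n * c))"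
  proof -
    \<comment> \<open>The induction step as an identity of fractions, with letters for the pairings.
      The factor n + 1 of the new boundary term, which by \<open>e\<close> contains (n + 1) q_(2N),
      cancels against (2N+2)!.\<close>
    have main: "((p + q) / 2 * s + C - (p * (x2 - d) + q * (y2 - d)) / (2 * c))
        + (((p + q) * d' - p * (x1 - n * x2) - q * (y1 - n * y2)) / (2 * n * c) + C')
      = (p + q) / 2 * (s + d / c + d' / (n * c)) + (C + C')
        - (p * ((n+1) * x1) + q * ((n+1) * y1)) / (2 * ((n + 1) * n * c))"
      for p q s C C' x1 x2 y1 y2 d d' :: 'a
    proof -
      have 1: "(p * ((n+1) * x1) + q * ((n+1) * y1)) / (2 * ((n + 1) * n * c))
          = (p * x1 + q * y1) / (2 * n * c)"
      proof -
        have "(p * ((n+1) * x1) + q * ((n+1) * y1)) = (n+1) * (p * x1 + q * y1)"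
          "2 * ((n + 1) * n * c) = (n + 1) * (2 * n * c)" by (simp_all add: algebra_simps)
        then show ?thesis using c by simp
      qed
      have 2: "((p + q) * d' - p * (x1 - n * x2) - q * (y1 - n * y2)) / (2 * n * c)
          = (p + q) * d' / (2 * n * c) - (p * x1 + q * y1) / (2 * n * c) + (p * x2 + q * y2) / (2 * c)"
      proof -
        have "(p + q) * d' - p * (x1 - n * x2) - q * (y1 - n * y2)
            = (p + q) * d' - (p * x1 + q * y1) + n * (p * x2 + q * y2)"
          by (simp add: algebra_simps)
        moreover have "n * (p * x2 + q * y2) / (2 * n * c) = (p * x2 + q * y2) / (2 * c)"
          using mult_divide_mult_cancel_left[OF c(2), of "p * x2 + q * y2" "2 * c"] by (simp only: mult_ac)
        ultimately show ?thesis by (simp only: add_divide_distrib diff_divide_distrib)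
      qed
      have 3: "(p * (x2 - d) + q * (y2 - d)) / (2 * c) = (p * x2 + q * y2) / (2 * c) - (p + q) * d / (2 * c)"
      proof -
        have "p * (x2 - d) + q * (y2 - d) = (p * x2 + q * y2) - (p + q) * d"
          by (simp add: algebra_simps)
        then show ?thesis by (simp only: diff_divide_distrib)
      qed
      have 4: "(p + q) / 2 * (s + d / c + d' / (n * c))
          = (p + q) / 2 * s + (p + q) * d / (2 * c) + (p + q) * d' / (2 * n * c)"
        by (simp only: distrib_left times_divide_times_eq mult.assoc)
      have "u + C - (v - w) + (x - y + v + C') = u + w + x + (C + C') - y" for u v w x y :: 'a
        by (simp add: algebra_simps)
      then show ?thesis unfolding 1 2 3 4 .
    qed
    have L: "of_nat (P + Q) * (\<Sum>k<Suc N. symplectic_term P Q k)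
        = of_nat (P + Q) * (\<Sum>k<N. symplectic_term P Q k) + of_nat (P + Q) * symplectic_term P Q N"
      "(1 - t\<^sup>2) * of_nat P * of_nat Q * (\<Sum>k<Suc N. symplectic_term (P-1) (Q-1) k)
       = (1 - t\<^sup>2) * of_nat P * of_nat Q * (\<Sum>k<N. symplectic_term (P-1) (Q-1) k)
         + (1 - t\<^sup>2) * of_nat P * of_nat Q * symplectic_term (P-1) (Q-1) N"
      by (simp_all only: sum.lessThan_Suc distrib_left)
    show ?thesis
      unfolding L IH step S unfolding of_nat_add[of P Q] by (rule main)
  qed
  then show ?case
    unfolding e f2 D_def a1_def b1_def mult_smult_right bilin by (simp only: add_2_eq_Suc' mult_Suc_right add_2_eq_Suc)
qed simp

section \<open>Skew-orthogonality for the weight z - conj z\<close>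

definition skew_poly :: "nat \<Rightarrow> 'a poly" where
  "skew_poly i = (if even i then even_skew_poly (i div 2) else herm t i)"

definition skew :: "'a poly \<Rightarrow> 'a poly \<Rightarrow> 'a" where
  "skew f g = B (pCons 0 f) g - B f (pCons 0 g)"

lemma skew_bilin: "skew (f + f') g = skew f g + skew f' g" "skew f (g + g') = skew f g + skew f g'"
  "skew (smult c f) g = c * skew f g" "skew f (smult c g) = c * skew f g"
  using add_left[of "pCons 0 f" "pCons 0 f'"] add_right[of _ "pCons 0 g" "pCons 0 g'"]
    smult_left[of c "pCons 0 f"] smult_right[of _ c "pCons 0 g"]
  by (simp_all add: skew_def bilin algebra_simps)

lemma skew_herm: "skew (herm t m) (herm t n)
   = (1 - t) * h * ((if n = Suc m then fact n else 0) - (if m = Suc n then fact m else 0))"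
  unfolding skew_def shift_diff pderiv_herm bilin herm_orth
  by (cases m; cases n) (auto simp: algebra_simps)

text \<open>\<open>skew\<close> couples only Hermite polynomials of neighbouring degrees. In the
  step from k to k + 1, the contribution - (2k+2)! of p_(2k+2) at l = k cancels (2k+2) (2k+1)! from
  the previous polynomial, and only l = k + 1 remains.\<close>

lemma skew_evenq_odd: "skew (even_skew_poly k) (herm t (2*l+1)) = (if k = l then (1 - t) * h * fact (2*l+1) else 0)"
proof (induction k)
  case 0
  show ?case using skew_herm[of 0 "2*l+1"] by (auto simp del: herm.simps(2))
next
  case (Suc k)
  show ?case unfolding even_skew_poly.simps skew_bilin Suc.IH skew_herm by (auto simp: algebra_simps)
qed

lemma skew_odd_evenq: "skew (herm t (2*l+1)) (even_skew_poly k) = (if k = l then - (1 - t) * h * fact (2*l+1) else 0)"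
proof (induction k)
  case 0
  show ?case using skew_herm[of "2*l+1" 0] by (auto simp: algebra_simps simp del: herm.simps(2))
next
  case (Suc k)
  show ?case unfolding even_skew_poly.simps skew_bilin Suc.IH skew_herm by (auto simp: algebra_simps)
qed

text \<open>Both arguments contain only Hermite polynomials of even degree, and neighbouring degrees
  differ in parity.\<close>

lemma skew_evenq_evenq: "skew (even_skew_poly k) (even_skew_poly l) = 0"
proof -
  have e: "skew (herm t (2*m)) (even_skew_poly l) = 0" for m l
  proof (induction l)
    case 0
    show ?case using skew_herm[of "2*m" 0] by (auto simp del: herm.simps(2))
  next
    case (Suc l)
    have "2*l+2 \<noteq> Suc (2*m)" "2*m \<noteq> Suc (2*l+2)" by presburger+
    then show ?case unfolding even_skew_poly.simps skew_bilin Suc.IH skew_herm by simp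
  qed
  show ?thesis
  proof (induction k)
    case 0
    show ?case using e[of 0] by simp
  next
    case (Suc k)
    show ?case using e[of "k+1"] unfolding even_skew_poly.simps skew_bilin Suc.IH by simp
  qed
qed

lemma skew_skew_poly: "skew (skew_poly i) (skew_poly j) =
   (if even i \<and> j = Suc i then (1 - t) * h * fact j else
    if odd i \<and> i = Suc j then - (1 - t) * h * fact i else 0)"
proof (cases "even i")
  case True
  then obtain k where k: "i = 2 * k" by blast
  show ?thesis
  proof (cases "even j")
    case True
    then show ?thesis using k by (auto simp: skew_poly_def skew_evenq_evenq)
  next
    case False
    then obtain l where "j = 2 * l + 1" by (metis oddE)
    then show ?thesis using k skew_evenq_odd[of k l] by (auto simp: skew_poly_def simp del: herm.simps)
  qed
next
  case False
  then obtain k where k: "i = 2 * k + 1" by (metis oddE)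
  show ?thesis
  proof (cases "even j")
    case True
    then obtain l where "j = 2 * l" by blast
    then show ?thesis using k skew_odd_evenq[of k l] by (auto simp: skew_poly_def simp del: herm.simps)
  next
    case False
    then have "j \<noteq> Suc i" "i \<noteq> Suc j" using k by auto
    then show ?thesis using k False by (simp add: skew_poly_def skew_herm del: herm.simps)
  qed
qed

lemma skew_poly_degree_lead: "degree (skew_poly i) = i \<and> coeff (skew_poly i) i = 1"
  using even_skew_poly_degree_lead[of "i div 2"] herm_degree_lead[of t i] by (auto simp: skew_poly_def)

end

section \<open>Hermite coefficients\<close>

text \<open>The l-th summand of (A^p)^j_k without its power of tau, in the variable a = (p + k -
  j)/2. Then j = k + p - 2a and (p - k + j)/2 = p - a, so the parity condition is built in.\<close>

definition ccoef :: "nat \<Rightarrow> int \<Rightarrow> int \<Rightarrow> nat \<Rightarrow> real" where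
  "ccoef p a k l = fact p / (2 ^ l * fact l) * invfact (int p - a - int l) * binomZ k (a - int l)"

text \<open>The convention 1/n! = 0 for negative n makes this valid at n = 0 too, so the recursions
  below need no boundary cases.\<close>

lemma invfact_rec: "of_int n * invfact n = invfact (n - 1)"
proof (cases "n \<le> 0")
  case False
  then obtain m where "n = int (Suc m)" by (metis not_le zero_less_imp_eq_int Suc_pred)
  then have "invfact n = 1 / fact (Suc m)" "invfact (n - 1) = 1 / fact m" "of_int n = real (Suc m)"
    by (simp_all add: invfact_def nat_add_distrib)
  then show ?thesis by (simp add: fact_Suc del: of_nat_Suc)
qed (auto simp: invfact_def)

lemma binomZ_rec:
  assumes "k \<ge> 0"
  shows "of_int (k - m) * binomZ k m = of_int (m + 1) * binomZ k (m + 1)"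
proof (cases "0 \<le> m \<and> m \<le> k")
  case True
  then obtain a b where ab: "m = int a" "k = int b" "a \<le> b"
    by (metis assms nonneg_int_cases of_nat_le_iff order_trans)
  have "real (b - a) * real (b choose a) = real (Suc a) * real (b choose (Suc a))"
    using binomial_absorb_comp[of b a] binomial_absorption[of a b]
    by (metis of_nat_mult)
  then show ?thesis using ab
    by (cases "a = b") (auto simp: binomZ_def of_nat_diff nat_add_distrib)
next
  case False
  then show ?thesis using assms by (cases "m = -1") (auto simp: binomZ_def)
qed

text \<open>The coefficient recursion coming from z p_n = p_(n+1) + t n p_(n-1) holds only after
  summation over l. \<open>G\<close> is a certificate in the manner of Zeilberger: the defect of
  each summand is a difference that telescopes.\<close>

lemma ccoef_rec:
  fixes a :: int and p :: nat
  assumes "k \<ge> 0"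
  defines "G \<equiv> (\<lambda>l. 2 * real l * (fact p / (2 ^ l * fact l)) * invfact (int p + 1 - a - int l) * binomZ k (a - int l))"
  shows "ccoef (Suc p) a k l - ccoef p a k l - of_int (k + int p + 2 - 2 * a) * ccoef p (a - 1) k l
    = G l - G (Suc l)"
proof -
  define c :: real where "c = fact p / (2 ^ l * fact l)"
  define I where "I = invfact (int p + 1 - a - int l)"
  define C where "C = binomZ k (a - int l)"
  define D where "D = binomZ k (a - 1 - int l)"
  have I1: "invfact (int p - a - int l) = of_int (int p + 1 - a - int l) * I"
    unfolding I_def invfact_rec by (simp add: algebra_simps)
  have CD: "of_int (k - (a - 1 - int l)) * D = of_int (a - int l) * C"
    using binomZ_rec[OF assms(1), of "a - 1 - int l"] by (simp add: C_def D_def)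
  have 1: "ccoef (Suc p) a k l = (real p + 1) * c * I * C"
    by (simp add: ccoef_def c_def I_def C_def algebra_simps)
  have 2: "ccoef p a k l = c * (of_int (int p + 1 - a - int l) * I) * C"
    unfolding ccoef_def I1 c_def C_def ..
  have 3: "ccoef p (a - 1) k l = c * I * D"
    unfolding ccoef_def c_def I_def D_def by (simp add: algebra_simps)
  have 4: "G l = 2 * real l * c * I * C" by (simp add: G_def c_def I_def C_def)
  have 5: "G (Suc l) = c * (of_int (int p + 1 - a - int l) * I) * D"
  proof -
    have "2 * real (Suc l) * (fact p / (2 ^ Suc l * fact (Suc l))) = c"
      by (simp add: c_def field_simps del: of_nat_Suc)
    moreover have "int p + 1 - a - int (Suc l) = int p - a - int l" "a - int (Suc l) = a - 1 - int l" by simp_all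
    ultimately show ?thesis unfolding G_def I1[symmetric] D_def by metis
  qed
  \<comment> \<open>The factor is split as (k - a + 1 + l) + (p + 1 - a - l): the first part is
    absorbed by the binomial coefficient, the second by the inverse factorial.\<close>
  have "of_int (k + int p + 2 - 2 * a) * (c * I * D)
      = c * I * (of_int (k - (a - 1 - int l)) * D) + c * (of_int (int p + 1 - a - int l) * I) * D"
    by (simp add: algebra_simps)
  then show ?thesis unfolding 1 2 3 4 5 CD by (simp add: algebra_simps)
qed

definition scoef :: "nat \<Rightarrow> int \<Rightarrow> int \<Rightarrow> real" where
  "scoef p a k = (\<Sum>l\<le>p div 2. ccoef p a k l)"

text \<open>A nonzero summand has l <= a and a + l <= p, hence 2 l <= p. This gives the sums for p
  and p + 1 a common range.\<close>

lemma scoef_extend: "p div 2 \<le> L \<Longrightarrow> scoef p a k = (\<Sum>l\<le>L. ccoef p a k l)"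
  unfolding scoef_def
  by (intro sum.mono_neutral_left) (auto simp: ccoef_def invfact_def binomZ_def)

lemma scoef_rec:
  assumes "k \<ge> 0"
  shows "scoef (Suc p) a k = scoef p a k + of_int (k + int p + 2 - 2 * a) * scoef p (a - 1) k"
proof -
  define G where "G = (\<lambda>l. 2 * real l * (fact p / (2 ^ l * fact l)) * invfact (int p + 1 - a - int l) * binomZ k (a - int l))"
  have e: "scoef q b k = (\<Sum>l<p + 2. ccoef q b k l)" if "q \<le> Suc p" for q b
    using scoef_extend[of q "Suc p" b k] that by (simp add: lessThan_Suc_atMost del: sum.lessThan_Suc)
  have "scoef (Suc p) a k - scoef p a k - of_int (k + int p + 2 - 2 * a) * scoef p (a - 1) k
     = (\<Sum>l<p + 2. G l - G (Suc l))"
    by (simp only: e order_refl le_SucI sum_distrib_left flip: sum_subtractf)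
       (intro sum.cong refl, simp only: ccoef_rec[OF assms] G_def)
  also have "\<dots> = G 0 - G (p + 2)" by (rule sum_lessThan_telescope')
  \<comment> \<open>\<open>G 0\<close> has the factor l = 0; at l = p + 2 the inverse factorial and
    the binomial coefficient cannot both be nonzero.\<close>
  also have "\<dots> = 0" by (auto simp: G_def invfact_def binomZ_def)
  finally show ?thesis by simp
qed

text \<open>A nonzero summand needs l <= a, a + l <= p and a - l <= k. In particular the coefficient
  vanishes wherever the index k + p - 2 * a of \<open>monom_mult_herm\<close> would be
  truncated.\<close>

lemma scoef_eq_0: "a < 0 \<or> int p < a \<or> k + int p < 2 * a \<Longrightarrow> scoef p a k = 0"
  unfolding scoef_def by (intro sum.neutral) (auto simp: ccoef_def invfact_def binomZ_def)

lemma Acoef_eq_scoef: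
  assumes "a \<le> p" "2 * a \<le> k + p"
  shows "Acoef \<tau> p (int (k + p - 2 * a)) (int k) = \<tau> ^ a * scoef p (int a) (int k)"
proof -
  have j: "int (k + p - 2 * a) = int k + int p - 2 * int a" using assms by (simp add: of_nat_diff)
  have 1: "(int p + int k - int (k + p - 2 * a)) div 2 = int a" unfolding j by simp
  have 2: "(int p - int k + int (k + p - 2 * a)) div 2 = int p - int a" unfolding j by simp
  have "\<exists>i. int (k + p - 2 * a) - int k = - int p + 2 * int i \<and> i \<le> p"
    by (rule exI[of _ "p - a"]) (use assms in \<open>simp add: of_nat_diff\<close>)
  then show ?thesis unfolding Acoef_def 1 2 scoef_def ccoef_def by simp
qed

lemma Acoef_support:
  assumes "Acoef \<tau> p j (int k) \<noteq> 0"
  obtains a where "a \<le> p" "2 * a \<le> k + p" "j = int (k + p - 2 * a)"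
proof -
  from assms obtain i where i: "j \<ge> 0" "j - int k = - int p + 2 * int i" "i \<le> p"
    unfolding Acoef_def by (auto split: if_splits)
  show ?thesis by (rule that[of "p - i"]) (use i in auto)
qed

lemma pCons_0_sum: "pCons 0 (sum f A) = (\<Sum>i\<in>A. pCons 0 (f i))"
proof (induction A rule: infinite_finite_induct)
  case (insert x F)
  have "pCons 0 (f x + sum f F) = pCons 0 (f x) + pCons 0 (sum f F)" by simp
  then show ?case using insert by simp
qed simp_all

text \<open>Induction on p: one more factor z splits each Hermite polynomial into one at the same a
  and one at a + 1, and \<open>scoef_rec\<close> merges the two families.\<close>

lemma monom_mult_herm:
  fixes \<tau> :: real and p k :: nat
  defines "t \<equiv> complex_of_real \<tau>"
  shows "monom 1 p * herm t k = (\<Sum>a\<le>p. smult (t ^ a * of_real (scoef p (int a) (int k))) (herm t (k + p - 2 * a)))"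
proof (induction p)
  case 0
  have "scoef 0 0 (int k) = 1" by (simp add: scoef_def ccoef_def invfact_def binomZ_def)
  then show ?case by (simp add: t_def)
next
  case (Suc p)
  define s where "s = (\<lambda>p a. complex_of_real (scoef p (int a) (int k)))"
  have s0: "s p a = 0" if "k + p < 2 * a" for a
    unfolding s_def by (subst scoef_eq_0) (use that in auto)
  have "monom 1 (Suc p) * herm t k = pCons 0 (\<Sum>a\<le>p. smult (t ^ a * s p a) (herm t (k + p - 2 * a)))"
    unfolding pCons_monom_mult[symmetric] Suc.IH s_def ..
  also have "\<dots> = (\<Sum>a\<le>p. smult (t ^ a * s p a) (pCons 0 (herm t (k + p - 2 * a))))"
    by (simp only: pCons_0_sum smult_pCons mult_zero_right)
  also have "\<dots> = (\<Sum>a\<le>p. smult (t ^ a * s p a) (herm t (k + Suc p - 2 * a))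
       + smult (t ^ Suc a * (of_nat (k + p - 2 * a) * s p a)) (herm t (k + Suc p - 2 * Suc a)))"
  proof (intro sum.cong refl)
    fix a assume "a \<in> {..p}"
    show "smult (t ^ a * s p a) (pCons 0 (herm t (k + p - 2 * a)))
      = smult (t ^ a * s p a) (herm t (k + Suc p - 2 * a))
       + smult (t ^ Suc a * (of_nat (k + p - 2 * a) * s p a)) (herm t (k + Suc p - 2 * Suc a))"
    proof (cases "k + p < 2 * a")
      case False
      then have "Suc (k + p - 2 * a) = k + Suc p - 2 * a" "k + p - 2 * a - 1 = k + Suc p - 2 * Suc a" by auto
      then show ?thesis unfolding pCons_herm by (simp add: smult_add_right mult_ac)
    qed (simp add: s0)
  qed
  also have "\<dots> = (\<Sum>a\<le>p. smult (t ^ a * s p a) (herm t (k + Suc p - 2 * a)))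
     + (\<Sum>a\<le>p. smult (t ^ Suc a * (of_nat (k + p - 2 * a) * s p a)) (herm t (k + Suc p - 2 * Suc a)))"
    by (rule sum.distrib)
  also have "(\<Sum>a\<le>p. smult (t ^ a * s p a) (herm t (k + Suc p - 2 * a)))
     = (\<Sum>a\<le>Suc p. smult (t ^ a * s p a) (herm t (k + Suc p - 2 * a)))"
    by (simp add: s_def scoef_eq_0)
  \<comment> \<open>The index a + 1 becomes a; the new term a = 0 vanishes because
    \<open>scoef p (-1)\<close> does.\<close>
  also have "(\<Sum>a\<le>p. smult (t ^ Suc a * (of_nat (k + p - 2 * a) * s p a)) (herm t (k + Suc p - 2 * Suc a)))
     = (\<Sum>a\<le>Suc p. smult (t ^ a * of_real (of_int (int k + int p + 2 - 2 * int a) * scoef p (int a - 1) (int k)))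
           (herm t (k + Suc p - 2 * a)))"
  proof -
    have "complex_of_real (of_int (int k + int p + 2 - 2 * int (Suc a)) * scoef p (int (Suc a) - 1) (int k))
       = of_nat (k + p - 2 * a) * s p a" for a
    proof (cases "k + p < 2 * a")
      case True
      then show ?thesis using s0[of a] by (simp add: s_def)
    qed (simp add: s_def of_nat_diff)
    then show ?thesis unfolding sum.atMost_Suc_shift[where n = p] by (simp add: scoef_eq_0)
  qed
  also have "(\<Sum>a\<le>Suc p. smult (t ^ a * s p a) (herm t (k + Suc p - 2 * a))) + \<dots>
     = (\<Sum>a\<le>Suc p. smult (t ^ a * of_real (scoef (Suc p) (int a) (int k))) (herm t (k + Suc p - 2 * a)))"
    unfolding sum.distrib[symmetric] smult_add_left[symmetric] s_def
    by (intro sum.cong refl arg_cong2[of _ _ _ _ smult]) (simp add: scoef_rec algebra_simps)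
  finally show ?case .
qed

lemma monom_mult_herm_Acoef:
  assumes "k + p \<le> n"
  shows "monom 1 p * herm (complex_of_real \<tau>) k
     = (\<Sum>j\<le>n. smult (of_real (Acoef \<tau> p (int j) (int k))) (herm (complex_of_real \<tau>) j))"
proof -
  let ?t = "complex_of_real \<tau>"
  \<comment> \<open>On \<open>?S\<close> the subtraction in \<open>?g\<close> is not truncated, so
    \<open>?g\<close> is injective and the degree can serve as summation index.\<close>
  let ?S = "{a. a \<le> p \<and> 2 * a \<le> k + p}" and ?g = "\<lambda>a. k + p - 2 * a"
  have "monom 1 p * herm ?t k = (\<Sum>a\<in>?S. smult (?t ^ a * of_real (scoef p (int a) (int k))) (herm ?t (?g a)))"
    unfolding monom_mult_herm by (intro sum.mono_neutral_right) (auto intro!: scoef_eq_0)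
  also have "\<dots> = (\<Sum>a\<in>?S. smult (of_real (Acoef \<tau> p (int (?g a)) (int k))) (herm ?t (?g a)))"
  proof (intro sum.cong refl)
    fix a assume "a \<in> ?S"
    then have "Acoef \<tau> p (int (?g a)) (int k) = \<tau> ^ a * scoef p (int a) (int k)"
      by (intro Acoef_eq_scoef) auto
    then show "smult (?t ^ a * of_real (scoef p (int a) (int k))) (herm ?t (?g a))
      = smult (of_real (Acoef \<tau> p (int (?g a)) (int k))) (herm ?t (?g a))"
      by (simp only: of_real_mult of_real_power)
  qed
  also have "\<dots> = (\<Sum>j\<in>?g ` ?S. smult (of_real (Acoef \<tau> p (int j) (int k))) (herm ?t j))"
    by (subst sum.reindex) (auto simp: inj_on_def)
  also have "\<dots> = (\<Sum>j\<le>n. smult (of_real (Acoef \<tau> p (int j) (int k))) (herm ?t j))"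
  proof (intro sum.mono_neutral_left ballI)
    show "?g ` ?S \<subseteq> {..n}" using assms by auto
    fix j assume "j \<in> {..n} - ?g ` ?S"
    then have "Acoef \<tau> p (int j) (int k) = 0"
      by (metis (mono_tags, lifting) Acoef_support DiffD2 imageI mem_Collect_eq of_nat_eq_iff)
    then show "smult (of_real (Acoef \<tau> p (int j) (int k))) (herm ?t j) = 0" by simp
  qed simp
  finally show ?thesis .
qed

text \<open>The integer ranges of the theorem may reach below 0 or past all occurring degrees; only
  the support of the summand matters.\<close>

lemma sum_int_interval_eq:
  fixes f :: "int \<Rightarrow> 'b::comm_monoid_add"
  assumes "\<And>n. f n \<noteq> 0 \<Longrightarrow> lo \<le> n \<and> n \<le> hi \<and> 0 \<le> n \<and> n \<le> int m"
  shows "(\<Sum>n\<in>{lo..hi}. f n) = (\<Sum>j\<le>m. f (int j))"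
proof -
  have "(\<Sum>j\<le>m. f (int j)) = (\<Sum>n\<in>int ` {..m}. f n)" by (subst sum.reindex) auto
  also have "\<dots> = (\<Sum>n\<in>{lo..hi} \<inter> int ` {..m}. f n)"
    using assms by (intro sum.mono_neutral_right) auto
  also have "\<dots> = (\<Sum>n\<in>{lo..hi}. f n)"
  proof (intro sum.mono_neutral_left ballI)
    fix n assume n: "n \<in> {lo..hi} - {lo..hi} \<inter> int ` {..m}"
    show "f n = 0"
    proof (rule ccontr)
      assume "f n \<noteq> 0"
      from assms[OF this] have "n = int (nat n)" "nat n \<le> m" by auto
      then show False using n by (metis DiffD1 DiffD2 IntI atMost_iff imageI)
    qed
  qed auto
  finally show ?thesis by simp
qed

lemma (in hermite_pairing) herm_pairing_sum:
  "B (\<Sum>j\<le>n. smult (a j) (herm t j)) (\<Sum>j\<le>n. smult (b j) (herm t j)) = h * (\<Sum>j\<le>n. fact j * a j * b j)"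
  by (simp add: sum_left sum_right smult_left smult_right herm_orth if_distrib sum.delta sum_distrib_left mult_ac
      cong: if_cong)

text \<open>The range only has to contain the support of one factor, since the product vanishes
  outside either. In (ii) it is centred at 2N and may miss degrees near 2k.\<close>

lemma pairing_Acoef:
  fixes \<tau> :: real
  assumes "hermite_pairing (complex_of_real \<tau>) h B"
    and r: "lo \<le> int k - int p \<and> int k + int p \<le> hi \<or> lo \<le> int l - int q \<and> int l + int q \<le> hi"
  shows "B (monom 1 p * herm (of_real \<tau>) k) (monom 1 q * herm (of_real \<tau>) l)
    = h * of_real (\<Sum>n\<in>{lo..hi}. factZ n * (Acoef \<tau> p n (int k) * Acoef \<tau> q n (int l)))"
proof -
  interpret hermite_pairing "complex_of_real \<tau>" h B by fact
  define m where "m = max (k + p) (l + q)"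
  have "(\<Sum>n\<in>{lo..hi}. factZ n * (Acoef \<tau> p n (int k) * Acoef \<tau> q n (int l)))
    = (\<Sum>j\<le>m. factZ (int j) * (Acoef \<tau> p (int j) (int k) * Acoef \<tau> q (int j) (int l)))"
  proof (rule sum_int_interval_eq)
    fix n assume "factZ n * (Acoef \<tau> p n (int k) * Acoef \<tau> q n (int l)) \<noteq> 0"
    then have "Acoef \<tau> p n (int k) \<noteq> 0" "Acoef \<tau> q n (int l) \<noteq> 0" by auto
    then obtain a b where "a \<le> p" "2 * a \<le> k + p" "n = int (k + p - 2 * a)"
      "b \<le> q" "2 * b \<le> l + q" "n = int (l + q - 2 * b)" by (metis Acoef_support)
    then show "lo \<le> n \<and> n \<le> hi \<and> 0 \<le> n \<and> n \<le> int m" using r by (auto simp: m_def)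
  qed
  moreover have "B (monom 1 p * herm (of_real \<tau>) k) (monom 1 q * herm (of_real \<tau>) l)
    = h * (\<Sum>j\<le>m. fact j * of_real (Acoef \<tau> p (int j) (int k)) * of_real (Acoef \<tau> q (int j) (int l)))"
    using monom_mult_herm_Acoef[of k p m \<tau>] monom_mult_herm_Acoef[of l q m \<tau>]
    by (simp add: m_def herm_pairing_sum)
  ultimately show ?thesis by (simp add: factZ_def mult.assoc)
qed

section \<open>Vandermonde determinants of monic polynomials\<close>

lemma prod_pairs_Suc:
  fixes f :: "nat \<Rightarrow> nat \<Rightarrow> 'a::comm_monoid_mult"
  shows "(\<Prod>a<Suc n. \<Prod>b\<in>{a<..<Suc n}. f a b) = (\<Prod>a<n. \<Prod>b\<in>{a<..<n}. f a b) * (\<Prod>a<n. f a n)"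
proof -
  have "(\<Prod>b\<in>{a<..<Suc n}. f a b) = (\<Prod>b\<in>{a<..<n}. f a b) * f a n" if "a < n" for a
  proof -
    have "{a<..<Suc n} = insert n {a<..<n}" using that by auto
    then show ?thesis by (simp add: mult.commute)
  qed
  moreover have "{n<..<Suc n} = {}" by auto
  ultimately show ?thesis by (simp add: prod.distrib)
qed

definition eval_det :: "(nat \<Rightarrow> 'a::comm_ring_1 poly) \<Rightarrow> nat \<Rightarrow> (nat \<Rightarrow> 'a) \<Rightarrow> 'a" where
  "eval_det q n x = (\<Sum>\<sigma> | \<sigma> permutes {..<n}. of_int (sign \<sigma>) * (\<Prod>j<n. poly (q (\<sigma> j)) (x j)))"

lemma eval_det_eq_det: "eval_det q n x = det (mat n n (\<lambda>(i, j). poly (q j) (x i)))"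
  unfolding eval_det_def
  by (subst det_def'[of _ n]) (auto simp: lessThan_atLeast0 permutes_in_image intro!: sum.cong prod.cong)

lemma eval_det_eq_zero:
  assumes "i < n" "j < n" "i \<noteq> j" "x i = x j"
  shows "eval_det q n x = 0"
  unfolding eval_det_eq_det
  by (rule det_identical_rows[OF _ assms(3,1,2)]) (use assms in \<open>auto intro!: eq_vecI\<close>)

text \<open>Expanding along the last row, the determinant is a polynomial of degree at most $n$ in the
  last point; it vanishes at the other points, and its leading coefficient is the smaller determinant.\<close>

lemma vandermonde_monic:
  fixes q :: "nat \<Rightarrow> 'a::{idom} poly"
  assumes "\<And>i. degree (q i) = i \<and> coeff (q i) i = 1"
  shows "eval_det q n x = (\<Prod>j<n. \<Prod>k\<in>{j<..<n}. x k - x j)"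
proof (induction n)
  case 0
  show ?case by (simp add: eval_det_def)
next
  case (Suc n)
  show ?case
  \<comment> \<open>If two of the first n points coincide, both sides are 0; otherwise they are the
    n distinct roots for the root count below.\<close>
  proof (cases "inj_on x {..<n}")
    case False
    then obtain i j where ij: "i < n" "j < n" "i \<noteq> j" "x i = x j" by (auto simp: inj_on_def)
    then have "eval_det q (Suc n) x = 0" "eval_det q n x = 0"
      by (auto intro: eval_det_eq_zero[of i _ j])
    then show ?thesis using Suc.IH by (simp only: prod_pairs_Suc) simp
  next
    case True
    define M where "M = (\<lambda>y. mat (Suc n) (Suc n) (\<lambda>(i, j). poly (q j) (if i = n then y else x i)))"
    define R where "R = (\<Sum>j<Suc n. smult (cofactor (M 0) n j) (q j))"
    \<comment> \<open>Only the last row of \<open>M y\<close> depends on y, and the deletion removes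
      it.\<close>
    have cof: "cofactor (M y) n j = cofactor (M 0) n j" for y j
    proof -
      have "mat_delete (M y) n j = mat_delete (M 0) n j"
        unfolding mat_delete_def M_def by (intro eq_matI) auto
      then show ?thesis unfolding cofactor_def by simp
    qed
    have R: "poly R y = eval_det q (Suc n) (\<lambda>i. if i = n then y else x i)" for y
    proof -
      have carr: "M y \<in> carrier_mat (Suc n) (Suc n)" unfolding M_def by (rule mat_carrier)
      have 1: "eval_det q (Suc n) (\<lambda>i. if i = n then y else x i) = det (M y)"
        unfolding eval_det_eq_det M_def ..
      have 2: "det (M y) = (\<Sum>j<Suc n. M y $$ (n, j) * cofactor (M y) n j)"
        using laplace_expansion_row[OF carr lessI] .
      have 3: "(\<Sum>j<Suc n. M y $$ (n, j) * cofactor (M y) n j) = poly R y"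
        unfolding cof[of y] R_def poly_sum
      proof (intro sum.cong refl)
        fix j assume "j \<in> {..<Suc n}"
        then have "M y $$ (n, j) = poly (q j) y" by (simp add: M_def)
        then show "M y $$ (n, j) * cofactor (M 0) n j = poly (smult (cofactor (M 0) n j) (q j)) y"
          by (simp only: poly_smult mult.commute)
      qed
      from 1 2 3 show ?thesis by (simp only:)
    qed
    have top: "cofactor (M 0) n n = eval_det q n x"
    proof -
      have "mat_delete (M 0) n n = mat n n (\<lambda>(i, j). poly (q j) (x i))"
        unfolding mat_delete_def M_def by (intro eq_matI) auto
      then show ?thesis unfolding cofactor_def eval_det_eq_det by (simp flip: mult_2)
    qed
    define P where "P = (\<Prod>i<n. [:- x i, 1:])"
    have P: "degree P = n" "coeff P n = 1"
    proof -
      show d: "degree P = n"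
        unfolding P_def by (subst degree_prod_eq_sum_degree) auto
      have "lead_coeff P = 1" unfolding P_def by (simp add: lead_coeff_prod)
      then show "coeff P n = 1" using d by simp
    qed
    have "R = smult (eval_det q n x) P"
    proof (rule ccontr)
      assume neq: "R \<noteq> smult (eval_det q n x) P"
      define S where "S = R - smult (eval_det q n x) P"
      have "S \<noteq> 0" using neq by (simp add: S_def)
      have c: "coeff R n = eval_det q n x"
      proof -
        have "coeff (q j) n = 0" if "j < n" for j
          by (rule coeff_eq_0) (use assms[of j] that in simp)
        then have "coeff (\<Sum>j<n. smult (cofactor (M 0) n j) (q j)) n = 0"
          unfolding coeff_sum by (intro sum.neutral ballI) simp
        then show ?thesis unfolding R_def sum.lessThan_Suc using assms[of n] by (simp add: top)
      qed
      have "degree R \<le> n" unfolding R_def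
        by (rule degree_sum_le) (use assms in \<open>auto intro: order_trans[OF degree_smult_le]\<close>)
      then have "degree S \<le> n" unfolding S_def
        using P degree_smult_le[of "eval_det q n x" P] by (intro degree_diff_le) auto
      moreover have "coeff S n = 0" by (simp add: S_def c P)
      ultimately have lt: "degree S < n"
        using \<open>S \<noteq> 0\<close> by (metis le_neq_implies_less leading_coeff_0_iff)
      have "x ` {..<n} \<subseteq> {y. poly S y = 0}"
      proof safe
        fix i assume i: "i < n"
        have "poly R (x i) = 0" unfolding R
          by (rule eval_det_eq_zero[of i _ n]) (use i in auto)
        moreover have "poly P (x i) = 0" using i by (auto simp: P_def poly_prod intro!: prod_zero)
        ultimately show "poly S (x i) = 0" by (simp add: S_def)
      qed
      then have "card (x ` {..<n}) \<le> card {y. poly S y = 0}"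
        by (rule card_mono[OF poly_roots_finite[OF \<open>S \<noteq> 0\<close>]])
      then have "n \<le> card {y. poly S y = 0}" by (simp only: card_image[OF True] card_lessThan)
      then show False using card_poly_roots_bound[OF \<open>S \<noteq> 0\<close>] lt by simp
    qed
    then have "poly R (x n) = eval_det q n x * (\<Prod>a<n. x n - x a)"
      by (simp add: P_def poly_prod)
    moreover have "poly R (x n) = eval_det q (Suc n) x"
      unfolding R by (rule arg_cong[of _ _ "eval_det q (Suc n)"]) auto
    ultimately show ?thesis unfolding prod_pairs_Suc Suc.IH by simp
  qed
qed

section \<open>Expansion of the densities\<close>

lemma prod_double:
  fixes f :: "nat \<Rightarrow> 'a::comm_monoid_mult"
  shows "(\<Prod>m<2*n. f m) = (\<Prod>j<n. f (2*j) * f (2*j+1))"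
  by (induction n) (simp_all add: mult_ac)

lemma cmod_sq: "complex_of_real ((cmod w)\<^sup>2) = w * cnj w"
  by (simp only: complex_norm_square)

lemma eval_det_mult_cnj:
  fixes q :: "nat \<Rightarrow> complex poly"
  assumes "\<And>i. degree (q i) = i \<and> coeff (q i) i = 1"
  shows "complex_of_real (\<Prod>j<n. \<Prod>k\<in>{j<..<n}. (cmod (z j - z k))\<^sup>2)
    = eval_det q n z * eval_det q n (\<lambda>j. cnj (z j))"
  unfolding vandermonde_monic[OF assms] of_real_prod prod.distrib[symmetric] cmod_sq
  by (intro prod.cong refl) (simp add: algebra_simps)

text \<open>The interaction is a Vandermonde product over the 2n points z_0, conj z_0, z_1, conj
  z_1, ... except for one factor: of |z - conj z|^2 = (z - conj z)(conj z - z) that product contains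
  only conj z - z. The leftover z - conj z becomes the weight of \<open>skew\<close>.\<close>

lemma eval_det_conjugate_pairs:
  fixes q :: "nat \<Rightarrow> complex poly" and z :: "nat \<Rightarrow> complex"
  assumes "\<And>i. degree (q i) = i \<and> coeff (q i) i = 1"
  defines "w \<equiv> (\<lambda>m. if even m then z (m div 2) else cnj (z (m div 2)))"
  shows "complex_of_real ((\<Prod>j<n. \<Prod>k\<in>{j<..<n}. (cmod (z j - z k))\<^sup>2 * (cmod (z j - cnj (z k)))\<^sup>2)
      * (\<Prod>j<n. (cmod (z j - cnj (z j)))\<^sup>2))
    = eval_det q (2 * n) w * (\<Prod>j<n. z j - cnj (z j))"
proof (induction n)
  case 0
  show ?case by (simp add: eval_det_def)
next
  case (Suc n)
  have w: "w (2*n) = z n" "w (Suc (2*n)) = cnj (z n)" by (simp_all add: w_def)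
  have pr: "(\<Prod>a<2*n. g (w a)) = (\<Prod>j<n. g (z j) * g (cnj (z j)))" for g :: "complex \<Rightarrow> complex"
    unfolding prod_double by (simp add: w_def)
  let ?A = "\<Prod>j<n. \<Prod>k\<in>{j<..<n}. (cmod (z j - z k))\<^sup>2 * (cmod (z j - cnj (z k)))\<^sup>2"
  let ?B = "\<Prod>j<n. (cmod (z j - cnj (z j)))\<^sup>2"
  let ?C = "\<Prod>j<n. complex_of_real ((cmod (z j - z n))\<^sup>2 * (cmod (z j - cnj (z n)))\<^sup>2)"
  have "eval_det q (2 * Suc n) w = eval_det q (2 * n) w * ((\<Prod>a<2*n. z n - w a) * (\<Prod>a<2*n. cnj (z n) - w a))
      * (cnj (z n) - z n)"
    unfolding vandermonde_monic[OF assms(1)] mult_Suc_right add_2_eq_Suc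
    by (subst prod_pairs_Suc, subst prod_pairs_Suc) (simp add: w)
  also have "(\<Prod>a<2*n. z n - w a) * (\<Prod>a<2*n. cnj (z n) - w a) = ?C"
    unfolding pr[of "\<lambda>u. z n - u"] pr[of "\<lambda>u. cnj (z n) - u"] prod.distrib[symmetric] of_real_mult cmod_sq
    by (intro prod.cong refl) (simp add: algebra_simps)
  finally have V: "eval_det q (2 * Suc n) w = eval_det q (2 * n) w * ?C * (cnj (z n) - z n)" .
  have "complex_of_real (?A * (\<Prod>j<n. (cmod (z j - z n))\<^sup>2 * (cmod (z j - cnj (z n)))\<^sup>2)
      * (?B * (cmod (z n - cnj (z n)))\<^sup>2))
    = complex_of_real (?A * ?B) * ?C * complex_of_real ((cmod (z n - cnj (z n)))\<^sup>2)"
    by (simp only: of_real_mult of_real_prod mult_ac)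
  also have "\<dots> = eval_det q (2 * n) w * (\<Prod>j<n. z j - cnj (z j)) * ?C * ((z n - cnj (z n)) * (cnj (z n) - z n))"
    unfolding Suc.IH cmod_sq by simp
  also have "\<dots> = eval_det q (2 * Suc n) w * ((\<Prod>j<n. z j - cnj (z j)) * (z n - cnj (z n)))"
    unfolding V by (simp only: mult_ac)
  finally show ?case unfolding prod_pairs_Suc prod.lessThan_Suc .
qed

lemma densC_expansion:
  fixes q :: "nat \<Rightarrow> complex poly"
  assumes "\<And>i. degree (q i) = i \<and> coeff (q i) i = 1"
  shows "complex_of_real (densC \<tau> n z) = (\<Sum>(\<sigma>, \<rho>) \<in> {\<sigma>. \<sigma> permutes {..<n}} \<times> {\<sigma>. \<sigma> permutes {..<n}}.
     of_int (sign \<sigma> * sign \<rho>) * (\<Prod>j<n. poly (q (\<sigma> j)) (z j) * poly (q (\<rho> j)) (cnj (z j)) * of_real (omegaH \<tau> (z j))))"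
proof -
  have "complex_of_real (densC \<tau> n z)
      = eval_det q n z * eval_det q n (\<lambda>j. cnj (z j)) * (\<Prod>j<n. of_real (omegaH \<tau> (z j)))"
    unfolding densC_def of_real_mult eval_det_mult_cnj[OF assms] by (simp only: of_real_prod)
  also have "\<dots> = (\<Sum>\<sigma> | \<sigma> permutes {..<n}. \<Sum>\<rho> | \<rho> permutes {..<n}. of_int (sign \<sigma> * sign \<rho>) *
     (\<Prod>j<n. poly (q (\<sigma> j)) (z j) * poly (q (\<rho> j)) (cnj (z j)) * of_real (omegaH \<tau> (z j))))"
    unfolding eval_det_def sum_product unfolding sum_distrib_right prod.distrib of_int_mult
    by (intro sum.cong refl) (simp only: mult_ac)
  finally show ?thesis unfolding sum.cartesian_product .
qed

text \<open>One permutation of 2n indices replaces the two of the complex case: positions 2j and 2j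
  + 1 belong to the same integration variable z_j.\<close>

lemma densH_expansion:
  fixes q :: "nat \<Rightarrow> complex poly"
  assumes "\<And>i. degree (q i) = i \<and> coeff (q i) i = 1"
  shows "complex_of_real (densH \<tau> n z) = (\<Sum>\<sigma> \<in> {\<sigma>. \<sigma> permutes {..<2*n}}.
     of_int (sign \<sigma>) * (\<Prod>j<n. poly (q (\<sigma> (2*j))) (z j) * poly (q (\<sigma> (2*j+1))) (cnj (z j))
        * (z j - cnj (z j)) * of_real (omegaH \<tau> (z j))))"
proof -
  let ?w = "\<lambda>m. if even m then z (m div 2) else cnj (z (m div 2))"
  have "complex_of_real (densH \<tau> n z) = eval_det q (2*n) ?w * (\<Prod>j<n. z j - cnj (z j)) * (\<Prod>j<n. of_real (omegaH \<tau> (z j)))"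
    unfolding eval_det_conjugate_pairs[OF assms, symmetric]
    by (simp only: densH_def prod.distrib of_real_mult of_real_prod mult_ac)
  also have "\<dots> = (\<Sum>\<sigma> \<in> {\<sigma>. \<sigma> permutes {..<2*n}}.
     of_int (sign \<sigma>) * (\<Prod>j<n. poly (q (\<sigma> (2*j))) (z j) * poly (q (\<sigma> (2*j+1))) (cnj (z j))
        * (z j - cnj (z j)) * of_real (omegaH \<tau> (z j))))"
    unfolding eval_det_def prod_double sum_distrib_right prod.distrib
    by (intro sum.cong refl) (simp add: mult_ac)
  finally show ?thesis .
qed

section \<open>Combinatorics of the one-point insertion\<close>

text \<open>For sigma = rho the omitted factor is restored by a division, and permuting the sum
  removes sigma. Otherwise sigma and rho differ in at least two positions, so the product is 0 even
  with one position omitted.\<close>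

lemma insertion_sum_diagonal:
  fixes a b :: "nat \<Rightarrow> nat \<Rightarrow> 'a::field"
  assumes \<sigma>: "\<sigma> permutes {..<n}" and \<rho>: "\<rho> permutes {..<n}"
    and a0: "\<And>i j. a i j = 0 \<longleftrightarrow> i \<noteq> j"
  shows "(\<Sum>j<n. b (\<sigma> j) (\<rho> j) * (\<Prod>i\<in>{..<n} - {j}. a (\<sigma> i) (\<rho> i)))
    = (\<Sum>k<n. b k k / a k k) * (\<Prod>i<n. a (\<sigma> i) (\<rho> i))"
proof (cases "\<sigma> = \<rho>")
  case True
  have "b (\<sigma> j) (\<rho> j) * (\<Prod>i\<in>{..<n} - {j}. a (\<sigma> i) (\<rho> i))
      = b (\<sigma> j) (\<sigma> j) / a (\<sigma> j) (\<sigma> j) * (\<Prod>i<n. a (\<sigma> i) (\<rho> i))" if "j < n" for j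
    using that True a0 by (subst prod.remove[of "{..<n}" j]) auto
  then have "(\<Sum>j<n. b (\<sigma> j) (\<rho> j) * (\<Prod>i\<in>{..<n} - {j}. a (\<sigma> i) (\<rho> i)))
    = (\<Sum>j<n. b (\<sigma> j) (\<sigma> j) / a (\<sigma> j) (\<sigma> j)) * (\<Prod>i<n. a (\<sigma> i) (\<rho> i))"
    by (simp add: sum_distrib_right)
  also have "(\<Sum>j<n. b (\<sigma> j) (\<sigma> j) / a (\<sigma> j) (\<sigma> j)) = (\<Sum>k<n. b k k / a k k)"
    by (rule sum.permute[OF \<sigma>, unfolded o_def, symmetric])
  finally show ?thesis .
next
  case False
  have out: "\<sigma> i = \<rho> i" if "i \<notin> {..<n}" for i
    using that \<sigma> \<rho> by (simp add: permutes_not_in)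
  have *: "\<exists>i\<in>{..<n} - {j}. \<sigma> i \<noteq> \<rho> i" if "j < n" for j
  proof (rule ccontr)
    assume "\<not> ?thesis"
    then have eq: "\<sigma> i = \<rho> i" if "i \<noteq> j" for i using that out by (cases "i < n") auto
    obtain m where m: "\<rho> j = \<sigma> m" using permutes_surj[OF \<sigma>] by (metis surjD)
    have "m = j"
    proof (rule ccontr)
      assume "m \<noteq> j"
      then have "\<rho> j = \<rho> m" using eq m by simp
      then show False using permutes_inj[OF \<rho>] \<open>m \<noteq> j\<close> by (auto dest: injD)
    qed
    then have "\<sigma> = \<rho>" using eq m by (intro ext) metis
    with False show False by simp
  qed
  obtain i where "i < n" "\<sigma> i \<noteq> \<rho> i" using False out by (metis ext lessThan_iff)
  then have A: "(\<Prod>i<n. a (\<sigma> i) (\<rho> i)) = 0"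
    using a0 by (intro prod_zero) auto
  have B: "(\<Prod>i\<in>{..<n} - {j}. a (\<sigma> i) (\<rho> i)) = 0" if "j < n" for j
    using *[OF that] a0 by (intro prod_zero) auto
  have "x * (\<Prod>i\<in>{..<n} - {j}. a (\<sigma> i) (\<rho> i)) = 0" if "j \<in> {..<n}" for j x
    using B[of j] that by (simp only: lessThan_iff mult_zero_right)
  then show ?thesis unfolding A mult_zero_right by (intro sum.neutral ballI)
qed

text \<open>The partner in the pair 2k, 2k + 1: the one index whose skew polynomial is not
  skew-orthogonal to that of i.\<close>

definition sibling :: "nat \<Rightarrow> nat" where
  "sibling i = (if even i then Suc i else i - 1)"

lemma sibling_simps [simp]: "sibling (sibling i) = i" "sibling (2 * j) = Suc (2 * j)"
  "sibling (Suc (2 * j)) = 2 * j" "sibling i div 2 = i div 2" "sibling i \<noteq> i" "sibling i < 2 * n \<longleftrightarrow> i < 2 * n"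
  by (auto simp: sibling_def elim!: oddE evenE)

lemma div2_eq_iff_sibling: "i div 2 = j div 2 \<longleftrightarrow> i = j \<or> j = sibling i"
  unfolding sibling_def by (auto elim!: oddE evenE)

text \<open>Nonzero terms send every pair of neighbouring positions to a pair of siblings; if all but
  one position pairs go to sibling pairs, so does the last one.\<close>

lemma insertion_sum_pairs:
  fixes a b :: "nat \<Rightarrow> nat \<Rightarrow> 'a::field"
  assumes \<sigma>: "\<sigma> permutes {..<2*n}"
    and a0: "\<And>i j. a i j = 0 \<longleftrightarrow> j \<noteq> sibling i"
    and ab: "\<And>i. b i (sibling i) = c (i div 2) * a i (sibling i)"
  shows "(\<Sum>j<n. b (\<sigma> (2*j)) (\<sigma> (2*j+1)) * (\<Prod>i\<in>{..<n} - {j}. a (\<sigma> (2*i)) (\<sigma> (2*i+1))))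
    = (\<Sum>k<n. c k) * (\<Prod>i<n. a (\<sigma> (2*i)) (\<sigma> (2*i+1)))"
proof (cases "\<forall>i<n. \<sigma> (2*i+1) = sibling (\<sigma> (2*i))")
  case True
  have inj: "\<sigma> x = \<sigma> y \<longleftrightarrow> x = y" for x y using permutes_inj[OF \<sigma>] by (auto dest: injD)
  have "b (\<sigma> (2*j)) (\<sigma> (2*j+1)) * (\<Prod>i\<in>{..<n} - {j}. a (\<sigma> (2*i)) (\<sigma> (2*i+1)))
      = c (\<sigma> (2*j) div 2) * (\<Prod>i<n. a (\<sigma> (2*i)) (\<sigma> (2*i+1)))" if "j < n" for j
    using that True ab by (subst prod.remove[of "{..<n}" j]) (auto simp: mult.assoc)
  then have "(\<Sum>j<n. b (\<sigma> (2*j)) (\<sigma> (2*j+1)) * (\<Prod>i\<in>{..<n} - {j}. a (\<sigma> (2*i)) (\<sigma> (2*i+1))))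
      = (\<Sum>j<n. c (\<sigma> (2*j) div 2)) * (\<Prod>i<n. a (\<sigma> (2*i)) (\<sigma> (2*i+1)))"
    by (simp add: sum_distrib_right)
  also have "(\<Sum>j<n. c (\<sigma> (2*j) div 2)) = (\<Sum>k<n. c k)"
  proof -
    \<comment> \<open>Distinct position pairs go to distinct sibling pairs, so summing over
      positions sums over all pairs.\<close>
    have "inj_on (\<lambda>j. \<sigma> (2*j) div 2) {..<n}"
    proof (rule inj_onI)
      fix i j assume ij: "i \<in> {..<n}" "j \<in> {..<n}" "\<sigma> (2*i) div 2 = \<sigma> (2*j) div 2"
      then have "\<sigma> (2*j) = \<sigma> (2*i) \<or> \<sigma> (2*j) = \<sigma> (2*i+1)"
        using True div2_eq_iff_sibling by (metis lessThan_iff)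
      then show "i = j" unfolding inj by presburger
    qed
    moreover have "(\<lambda>j. \<sigma> (2*j) div 2) ` {..<n} \<subseteq> {..<n}"
    proof safe
      fix j assume "j < n"
      then have "\<sigma> (2*j) < 2*n" using permutes_in_image[OF \<sigma>, of "2*j"] by simp
      then show "\<sigma> (2*j) div 2 < n" by simp
    qed
    ultimately have "bij_betw (\<lambda>j. \<sigma> (2*j) div 2) {..<n} {..<n}"
      by (simp add: bij_betw_def endo_inj_surj)
    then show ?thesis by (rule sum.reindex_bij_betw)
  qed
  finally show ?thesis .
next
  case False
  have inj: "\<sigma> x = \<sigma> y \<longleftrightarrow> x = y" for x y using permutes_inj[OF \<sigma>] by (auto dest: injD)
  have *: "\<exists>i\<in>{..<n} - {j}. \<sigma> (2*i+1) \<noteq> sibling (\<sigma> (2*i))" if j: "j < n" for j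
  proof (rule ccontr)
    assume "\<not> ?thesis"
    then have eq: "\<sigma> (2*i+1) = sibling (\<sigma> (2*i))" if "i < n" "i \<noteq> j" for i using that by auto
    have "\<sigma> (2*j) < 2 * n" using j permutes_in_image[OF \<sigma>, of "2*j"] by simp
    then have "sibling (\<sigma> (2*j)) < 2*n" by simp
    then obtain m where m: "m < 2 * n" "\<sigma> m = sibling (\<sigma> (2*j))"
      using permutes_image[OF \<sigma>] by (metis imageE lessThan_iff)
    \<comment> \<open>Otherwise the intact pair containing m sends \<open>sibling m\<close> to the
      value at 2j, against injectivity.\<close>
    have "m div 2 = j"
    proof (rule ccontr)
      assume mj: "m div 2 \<noteq> j"
      have mn: "m div 2 < n" using m by simp
      have "\<sigma> (sibling m) = sibling (\<sigma> m)"
      proof (cases "even m")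
        case True
        then show ?thesis using eq[OF mn mj] by (auto elim!: evenE)
      next
        case False
        then show ?thesis using eq[OF mn mj] by (auto elim!: oddE)
      qed
      then have "\<sigma> (sibling m) = \<sigma> (2*j)" using m by simp
      then have "sibling m = 2 * j" by (simp add: inj)
      then show False using mj by (metis sibling_simps(4) nonzero_mult_div_cancel_left zero_neq_numeral)
    qed
    moreover have "m \<noteq> 2*j" using m(2) sibling_simps(5) by metis
    ultimately have "m = 2*j+1" by presburger
    then have "\<sigma> (2*i+1) = sibling (\<sigma> (2*i))" if "i < n" for i
      using that eq m by (cases "i = j") auto
    with False show False by blast
  qed
  have A: "(\<Prod>i<n. a (\<sigma> (2*i)) (\<sigma> (2*i+1))) = 0"
    using False a0 by (intro prod_zero) auto
  have B: "(\<Prod>i\<in>{..<n} - {j}. a (\<sigma> (2*i)) (\<sigma> (2*i+1))) = 0" if "j < n" for j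
    using *[OF that] a0 by (intro prod_zero) auto
  have "x * (\<Prod>i\<in>{..<n} - {j}. a (\<sigma> (2*i)) (\<sigma> (2*i+1))) = 0" if "j \<in> {..<n}" for j x
    using B[of j] that by (simp only: lessThan_iff mult_zero_right)
  then show ?thesis unfolding A mult_zero_right by (intro sum.neutral ballI)
qed

text \<open>Exchanging positions 2j and 2j + 1 flips the sign and fixes R, so only the antisymmetric
  part of b counts. The insertion itself need not be antisymmetric when p1 and p2 differ, whereas
  \<open>skew\<close> is; this is the origin of the 1/2 in \<open>symplectic_term\<close>.\<close>

lemma alternating_sum_swap:
  fixes b :: "nat \<Rightarrow> nat \<Rightarrow> 'a::field_char_0" and a :: "nat \<Rightarrow> nat \<Rightarrow> 'a"
  assumes j: "j < n"
  defines "R \<equiv> (\<lambda>\<sigma>. \<Prod>i\<in>{..<n} - {j}. a (\<sigma> (2*i)) (\<sigma> (2*i+1)))"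
  shows "(\<Sum>\<sigma> | \<sigma> permutes {..<2*n}. of_int (sign \<sigma>) * (b (\<sigma> (2*j)) (\<sigma> (2*j+1)) * R \<sigma>))
    = (\<Sum>\<sigma> | \<sigma> permutes {..<2*n}. of_int (sign \<sigma>) *
         ((b (\<sigma> (2*j)) (\<sigma> (2*j+1)) - b (\<sigma> (2*j+1)) (\<sigma> (2*j))) / 2 * R \<sigma>))"
proof -
  let ?t = "Transposition.transpose (2*j) (2*j+1)"
  have t: "?t permutes {..<2*n}" by (rule permutes_swap_id) (use j in auto)
  have R: "R (\<sigma> \<circ> ?t) = R \<sigma>" for \<sigma>
    unfolding R_def
  proof (intro prod.cong refl)
    fix i assume "i \<in> {..<n} - {j}"
    then have "?t (2*i) = 2*i" "?t (2*i+1) = 2*i+1"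
      by (auto simp: Transposition.transpose_def)
    then show "a ((\<sigma> \<circ> ?t) (2*i)) ((\<sigma> \<circ> ?t) (2*i+1)) = a (\<sigma> (2*i)) (\<sigma> (2*i+1))" by simp
  qed
  let ?X = "\<Sum>\<sigma> | \<sigma> permutes {..<2*n}. of_int (sign \<sigma>) * (b (\<sigma> (2*j)) (\<sigma> (2*j+1)) * R \<sigma>)"
  let ?Y = "\<Sum>\<sigma> | \<sigma> permutes {..<2*n}. of_int (sign \<sigma>) * (b (\<sigma> (2*j+1)) (\<sigma> (2*j)) * R \<sigma>)"
  have "?X = (\<Sum>\<sigma> | \<sigma> permutes {..<2*n}. of_int (sign (\<sigma> \<circ> ?t)) *
       (b ((\<sigma> \<circ> ?t) (2*j)) ((\<sigma> \<circ> ?t) (2*j+1)) * R (\<sigma> \<circ> ?t)))"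
    by (rule sum_permutations_compose_right[OF t])
  also have "\<dots> = - ?Y"
    unfolding R sum_negf[symmetric]
  proof (intro sum.cong refl)
    fix \<sigma> assume "\<sigma> \<in> {\<sigma>. \<sigma> permutes {..<2*n}}"
    then have "sign (\<sigma> \<circ> ?t) = - sign \<sigma>"
      using t by (subst sign_compose) (auto simp: sign_swap_id intro: permutes_imp_permutation[of "{..<2*n}"])
    then show "of_int (sign (\<sigma> \<circ> ?t)) * (b ((\<sigma> \<circ> ?t) (2*j)) ((\<sigma> \<circ> ?t) (2*j+1)) * R \<sigma>)
       = - (of_int (sign \<sigma>) * (b (\<sigma> (2*j+1)) (\<sigma> (2*j)) * R \<sigma>))"
      by (simp add: Transposition.transpose_def)
  qed
  finally have "?X = (?X - ?Y) / 2" by (simp add: field_simps)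
  also have "\<dots> = (\<Sum>\<sigma> | \<sigma> permutes {..<2*n}. of_int (sign \<sigma>) *
         ((b (\<sigma> (2*j)) (\<sigma> (2*j+1)) - b (\<sigma> (2*j+1)) (\<sigma> (2*j))) / 2 * R \<sigma>))"
    unfolding sum_subtractf[symmetric] sum_divide_distrib
    by (intro sum.cong refl) (simp add: field_simps)
  finally show ?thesis .
qed

section \<open>Gaussian integrals\<close>

lemma poly_monom_induct:
  assumes "\<And>a n. \<Phi> (monom a n)" "\<And>p q. \<Phi> p \<Longrightarrow> \<Phi> q \<Longrightarrow> \<Phi> (p + q)"
  shows "\<Phi> p"
proof -
  have "\<Phi> (\<Sum>i\<in>A. monom (c i) i)" for A and c :: "nat \<Rightarrow> 'a"
    by (induction A rule: infinite_finite_induct) (use assms(1)[of 0 0] assms in simp_all)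
  from this[of "coeff p" "{..degree p}"] show ?thesis by (simp only: poly_as_sum_of_monoms)
qed

text \<open>Unnormalised, with variance c/2, so that omega splits into c = 1 + tau in x and c = 1 -
  tau in y.\<close>

definition gauss :: "real \<Rightarrow> real \<Rightarrow> real" where
  "gauss c x = exp (- (x\<^sup>2 / c))"

lemma gauss_pos: "gauss c x > 0" by (simp add: gauss_def)

lemma borel_measurable_gauss [measurable]: "gauss c \<in> borel_measurable borel"
  unfolding gauss_def by measurable

lemma gauss_eq_normal_density:
  assumes "c > 0"
  shows "gauss c x = sqrt (pi * c) * normal_density 0 (sqrt (c / 2)) x"
  using assms by (simp add: gauss_def normal_density_def)

lemma gauss_moment_even:
  assumes "c > 0"
  shows "has_bochner_integral lborel (\<lambda>x. gauss c x * x ^ (2 * k)) (sqrt (pi * c) * (fact (2 * k) / ((4 / c) ^ k * fact k)))"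
proof -
  have "has_bochner_integral lborel (\<lambda>x. normal_density 0 (sqrt (c / 2)) x * (x - 0) ^ (2 * k))
     (fact (2 * k) / ((2 / (sqrt (c / 2))\<^sup>2) ^ k * fact k))"
    by (rule normal_moment_even) (use assms in simp)
  from has_bochner_integral_mult_right[OF this, of "sqrt (pi * c)"] show ?thesis
    using assms by (simp add: gauss_eq_normal_density mult.assoc)
qed

lemma gauss_moment_odd:
  assumes "c > 0"
  shows "has_bochner_integral lborel (\<lambda>x. gauss c x * x ^ (2 * k + 1)) 0"
proof -
  have "has_bochner_integral lborel (\<lambda>x. normal_density 0 (sqrt (c / 2)) x * (x - 0) ^ (2 * k + 1)) 0"
    by (rule normal_moment_odd) (use assms in simp)
  from has_bochner_integral_mult_right[OF this, of "sqrt (pi * c)"] show ?thesis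
    using assms by (simp add: gauss_eq_normal_density mult.assoc)
qed

lemma gauss_integrable_power:
  assumes "c > 0"
  shows "integrable lborel (\<lambda>x. gauss c x * x ^ k)"
proof (cases "even k")
  case True
  then obtain m where "k = 2 * m" by blast
  then show ?thesis using gauss_moment_even[OF assms, of m] by (simp add: has_bochner_integral_iff)
next
  case False
  then obtain m where "k = 2 * m + 1" by (metis oddE)
  then show ?thesis using gauss_moment_odd[OF assms, of m] by (simp only: has_bochner_integral_iff)
qed

text \<open>Integration by parts for monomials, read off from the closed forms of the normal
  moments: odd ones vanish, and for odd n the two even ones have the ratio c n / 2.\<close>

lemma gauss_moment_rec:
  assumes "c > 0"
  shows "(\<integral>x. gauss c x * x ^ (Suc n) \<partial>lborel) = c / 2 * real n * (\<integral>x. gauss c x * x ^ (n - 1) \<partial>lborel)"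
proof (cases "even n")
  case True
  then obtain m where m: "n = 2 * m" by blast
  have "(\<integral>x. gauss c x * x ^ (n - 1) \<partial>lborel) = 0" if "m \<noteq> 0"
  proof -
    have "n - 1 = 2 * (m - 1) + 1" using that m by simp
    then show ?thesis using gauss_moment_odd[OF assms, of "m - 1"] by (simp only: has_bochner_integral_iff)
  qed
  then show ?thesis using gauss_moment_odd[OF assms, of m] m
    by (cases "m = 0") (simp_all add: has_bochner_integral_iff)
next
  case False
  then obtain m where m: "n = 2 * m + 1" by (metis oddE)
  have e: "Suc n = 2 * Suc m" "n - 1 = 2 * m" using m by simp_all
  have "(\<integral>x. gauss c x * x ^ (Suc n) \<partial>lborel) = sqrt (pi * c) * (fact (2 * Suc m) / ((4 / c) ^ Suc m * fact (Suc m)))"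
    "(\<integral>x. gauss c x * x ^ (n - 1) \<partial>lborel) = sqrt (pi * c) * (fact (2 * m) / ((4 / c) ^ m * fact m))"
    unfolding e using gauss_moment_even[OF assms] by (simp_all only: has_bochner_integral_iff)
  moreover have "fact (2 * Suc m) / ((4 / c) ^ Suc m * fact (Suc m)) = c / 2 * real n * (fact (2 * m) / ((4 / c) ^ m * fact m))"
  proof -
    have "(fact (2 * Suc m) :: real) = (2 * real (Suc m)) * real n * fact (2 * m)"
      using m by (simp add: algebra_simps)
    moreover have "(4 / c) ^ Suc m * fact (Suc m) = (4 / c) * real (Suc m) * ((4 / c) ^ m * fact m)"
      by (simp add: algebra_simps)
    ultimately show ?thesis using assms by (simp add: field_simps del: of_nat_Suc fact_Suc power_Suc)
  qed
  ultimately show ?thesis by (simp only: mult.left_commute)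
qed

lemma gauss_integrable_poly:
  assumes "c > 0"
  shows "integrable lborel (\<lambda>x. poly P (of_real x) * complex_of_real (gauss c x))"
proof (induction P rule: poly_monom_induct)
  case (1 a n)
  have "integrable lborel (\<lambda>x. a * complex_of_real (gauss c x * x ^ n))"
    using gauss_integrable_power[OF assms] by (intro integrable_mult_right integrable_of_real) 
  then show ?case by (simp add: poly_monom mult_ac)
next
  case (2 p q)
  then show ?case by (simp add: distrib_right)
qed

lemma gauss_by_parts:
  assumes c: "c > 0"
  shows "(\<integral>x. of_real x * poly P (of_real x) * complex_of_real (gauss c x) \<partial>lborel)
    = of_real (c / 2) * (\<integral>x. poly (pderiv P) (of_real x) * complex_of_real (gauss c x) \<partial>lborel)"
proof (induction P rule: poly_monom_induct)
  case (1 a n)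
  have "(\<integral>x. of_real x * poly (monom a n) (of_real x) * complex_of_real (gauss c x) \<partial>lborel)
    = (\<integral>x. a * complex_of_real (gauss c x * x ^ Suc n) \<partial>lborel)"
    by (intro Bochner_Integration.integral_cong refl) (simp add: poly_monom mult_ac)
  also have "\<dots> = a * complex_of_real (c / 2 * real n * (\<integral>x. gauss c x * x ^ (n - 1) \<partial>lborel))"
    unfolding gauss_moment_rec[OF c, symmetric] by (simp only: integral_mult_right_zero integral_complex_of_real)
  also have "\<dots> = of_real (c / 2) * (\<integral>x. (of_nat n * a) * complex_of_real (gauss c x * x ^ (n - 1)) \<partial>lborel)"
    unfolding integral_mult_right_zero integral_complex_of_real
    by (simp only: of_real_mult of_real_of_nat_eq mult_ac)
  also have "(\<integral>x. (of_nat n * a) * complex_of_real (gauss c x * x ^ (n - 1)) \<partial>lborel)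
     = (\<integral>x. poly (pderiv (monom a n)) (of_real x) * complex_of_real (gauss c x) \<partial>lborel)"
    by (intro Bochner_Integration.integral_cong refl) (simp add: poly_monom pderiv_monom mult_ac)
  finally show ?case .
next
  case (2 p q)
  have i: "integrable lborel (\<lambda>x. of_real x * poly r (of_real x) * complex_of_real (gauss c x))" for r
    using gauss_integrable_poly[OF c, of "pCons 0 r"] by simp
  note i' = gauss_integrable_poly[OF c]
  show ?case
    by (simp only: pderiv_add poly_add distrib_left distrib_right Bochner_Integration.integral_add i i' 2)
qed

section \<open>Integration over the complex plane in real coordinates\<close>

lemma lborel_complex:
  "(lborel :: complex measure) = distr (lborel \<Otimes>\<^sub>M lborel) borel (\<lambda>p. of_real (fst p) + \<i> * of_real (snd p))"
proof (rule lborel_eqI)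
  let ?T = "\<lambda>p. complex_of_real (fst p) + \<i> * of_real (snd p)"
  have T[measurable]: "?T \<in> (lborel \<Otimes>\<^sub>M lborel) \<rightarrow>\<^sub>M borel" by measurable
  fix l u :: complex
  assume le: "\<And>b. b \<in> Basis \<Longrightarrow> l \<bullet> b \<le> u \<bullet> b"
  have lu: "Re l \<le> Re u" "Im l \<le> Im u"
    using le[of 1] le[of \<i>] by (simp_all add: Basis_complex_def)
  have "?T -` box l u = {Re l<..<Re u} \<times> {Im l<..<Im u}"
    by (auto simp: in_box_complex_iff)
  then show "emeasure (distr (lborel \<Otimes>\<^sub>M lborel) borel ?T) (box l u) = (\<Prod>b\<in>Basis. (u - l) \<bullet> b)"
    using lu by (simp add: emeasure_distr space_pair_measure lborel.emeasure_pair_measure_Times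
       Basis_complex_def ennreal_mult)
qed simp

lemma integrable_pair_times:
  fixes f g :: "real \<Rightarrow> real"
  assumes f: "integrable lborel f" and g: "integrable lborel g"
  shows "integrable (lborel \<Otimes>\<^sub>M lborel) (\<lambda>p. f (fst p) * g (snd p))"
proof (rule lborel_pair.Fubini_integrable)
  have [measurable]: "f \<in> borel_measurable borel" "g \<in> borel_measurable borel"
    using f g borel_measurable_integrable by fastforce+
  show "(\<lambda>p. f (fst p) * g (snd p)) \<in> borel_measurable (lborel \<Otimes>\<^sub>M lborel)" by measurable
  have "integrable lborel (\<lambda>x. norm (f x) * (\<integral>y. norm (g y) \<partial>lborel))"
    using f by (intro integrable_mult_left integrable_norm)
  then show "integrable lborel (\<lambda>x. \<integral>y. norm (f (fst (x, y)) * g (snd (x, y))) \<partial>lborel)"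
    by (simp add: abs_mult)
  show "AE x in lborel. integrable lborel (\<lambda>y. f (fst (x, y)) * g (snd (x, y)))"
    using g by simp
qed

lemma omegaH_eq_gauss:
  assumes "-1 < \<tau>" "\<tau> < 1"
  shows "omegaH \<tau> (of_real x + \<i> * of_real y) = gauss (1 + \<tau>) x * gauss (1 - \<tau>) y"
proof -
  have "1 + \<tau> > 0" "1 - \<tau> > 0" "1 - \<tau>\<^sup>2 = (1 + \<tau>) * (1 - \<tau>)"
    using assms by (simp_all add: power2_eq_square algebra_simps)
  moreover have "(cmod (of_real x + \<i> * of_real y))\<^sup>2 - \<tau> * Re ((of_real x + \<i> * of_real y)\<^sup>2)
      = (1 - \<tau>) * x\<^sup>2 + (1 + \<tau>) * y\<^sup>2"
  proof -
    have "(cmod (of_real x + \<i> * of_real y))\<^sup>2 = x\<^sup>2 + y\<^sup>2" by (simp add: cmod_power2)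
    moreover have "Re ((of_real x + \<i> * of_real y)\<^sup>2) = x\<^sup>2 - y\<^sup>2" by (simp add: power2_eq_square)
    ultimately show ?thesis by (simp only:) (simp add: algebra_simps)
  qed
  ultimately show ?thesis
    unfolding omegaH_def gauss_def exp_add[symmetric]
    by (simp only: minus_divide_left) (simp add: field_simps)
qed

text \<open>Both |x + iy| and |x - iy| are at most |x| + |y|, and (|x| + |y|)^k <= 2^k (|x|^k +
  |y|^k); this dominates the integrand by a sum of products of integrable functions of one
  variable.\<close>

lemma integrable_monomial_gauss:
  assumes "-1 < \<tau>" "\<tau> < 1"
  shows "integrable (lborel \<Otimes>\<^sub>M lborel) (\<lambda>p. (of_real (fst p) + \<i> * of_real (snd p)) ^ m
     * (of_real (fst p) - \<i> * of_real (snd p)) ^ n * complex_of_real (gauss (1 + \<tau>) (fst p) * gauss (1 - \<tau>) (snd p)))"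
proof -
  have c: "1 + \<tau> > 0" "1 - \<tau> > 0" using assms by simp_all
  let ?g = "\<lambda>p. gauss (1 + \<tau>) (fst p) * gauss (1 - \<tau>) (snd p)"
  let ?k = "m + n"
  have i: "integrable lborel (\<lambda>x. gauss c x * \<bar>x\<bar> ^ k)" if "c > 0" for c k
    using integrable_norm[OF gauss_integrable_power[OF that, of k]] gauss_pos[of c]
    by (simp add: abs_mult power_abs abs_of_pos)
  have "integrable (lborel \<Otimes>\<^sub>M lborel) (\<lambda>p. 2 ^ ?k *
      ((gauss (1 + \<tau>) (fst p) * \<bar>fst p\<bar> ^ ?k) * gauss (1 - \<tau>) (snd p)
      + gauss (1 + \<tau>) (fst p) * (gauss (1 - \<tau>) (snd p) * \<bar>snd p\<bar> ^ ?k)))"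
    using i[OF c(1), of 0] i[OF c(2), of 0]
    by (intro integrable_mult_right Bochner_Integration.integrable_add
      integrable_pair_times[of "\<lambda>x. gauss (1 + \<tau>) x * \<bar>x\<bar> ^ ?k" "gauss (1 - \<tau>)"]
      integrable_pair_times[of "gauss (1 + \<tau>)" "\<lambda>x. gauss (1 - \<tau>) x * \<bar>x\<bar> ^ ?k"] i c) simp_all
  then show ?thesis
  proof (rule Bochner_Integration.integrable_bound)
    show "AE p in lborel \<Otimes>\<^sub>M lborel. norm ((of_real (fst p) + \<i> * of_real (snd p)) ^ m
       * (of_real (fst p) - \<i> * of_real (snd p)) ^ n * complex_of_real (?g p))
      \<le> norm (2 ^ ?k * ((gauss (1 + \<tau>) (fst p) * \<bar>fst p\<bar> ^ ?k) * gauss (1 - \<tau>) (snd p)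
      + gauss (1 + \<tau>) (fst p) * (gauss (1 - \<tau>) (snd p) * \<bar>snd p\<bar> ^ ?k)))"
    proof (intro always_eventually allI)
      fix p :: "real \<times> real"
      obtain x y where p: "p = (x, y)" by force
      have b: "(\<bar>x\<bar> + \<bar>y\<bar>) ^ ?k \<le> 2 ^ ?k * (\<bar>x\<bar> ^ ?k + \<bar>y\<bar> ^ ?k)"
      proof -
        have "(\<bar>x\<bar> + \<bar>y\<bar>) ^ ?k \<le> (2 * max \<bar>x\<bar> \<bar>y\<bar>) ^ ?k" by (intro power_mono) auto
        also have "\<dots> \<le> 2 ^ ?k * (\<bar>x\<bar> ^ ?k + \<bar>y\<bar> ^ ?k)"
          unfolding power_mult_distrib by (intro mult_left_mono) (auto simp: max_def)
        finally show ?thesis .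
      qed
      have n: "norm (complex_of_real x + \<i> * of_real y) \<le> \<bar>x\<bar> + \<bar>y\<bar>"
        "norm (complex_of_real x - \<i> * of_real y) \<le> \<bar>x\<bar> + \<bar>y\<bar>"
        using norm_triangle_ineq[of "complex_of_real x" "\<i> * of_real y"]
          norm_triangle_ineq4[of "complex_of_real x" "\<i> * of_real y"] by (simp_all add: norm_mult)
      have g: "?g p > 0" by (simp add: gauss_pos)
      have "norm ((complex_of_real x + \<i> * of_real y) ^ m * (of_real x - \<i> * of_real y) ^ n)
          \<le> (\<bar>x\<bar> + \<bar>y\<bar>) ^ m * (\<bar>x\<bar> + \<bar>y\<bar>) ^ n"
        unfolding norm_mult norm_power using n by (intro mult_mono power_mono) auto
      also have "\<dots> \<le> 2 ^ ?k * (\<bar>x\<bar> ^ ?k + \<bar>y\<bar> ^ ?k)"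
        using b by (simp only: power_add)
      finally have "norm ((complex_of_real x + \<i> * of_real y) ^ m * (of_real x - \<i> * of_real y) ^ n) * ?g p
          \<le> 2 ^ ?k * (\<bar>x\<bar> ^ ?k + \<bar>y\<bar> ^ ?k) * ?g p"
        using g by (intro mult_right_mono) auto
      also have "\<dots> = 2 ^ ?k * ((gauss (1 + \<tau>) (fst p) * \<bar>fst p\<bar> ^ ?k) * gauss (1 - \<tau>) (snd p)
        + gauss (1 + \<tau>) (fst p) * (gauss (1 - \<tau>) (snd p) * \<bar>snd p\<bar> ^ ?k))"
        by (simp add: p algebra_simps)
      also have "\<dots> \<le> norm \<dots>" by simp
      finally have F: "norm ((complex_of_real x + \<i> * of_real y) ^ m * (of_real x - \<i> * of_real y) ^ n) * ?g p
        \<le> norm (2 ^ ?k * ((gauss (1 + \<tau>) (fst p) * \<bar>fst p\<bar> ^ ?k) * gauss (1 - \<tau>) (snd p)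
          + gauss (1 + \<tau>) (fst p) * (gauss (1 - \<tau>) (snd p) * \<bar>snd p\<bar> ^ ?k)))" .
      have e: "norm (w * complex_of_real (?g p)) = norm w * ?g p" for w
        using g by (simp only: norm_mult norm_of_real abs_of_pos)
      show "norm ((of_real (fst p) + \<i> * of_real (snd p)) ^ m
       * (of_real (fst p) - \<i> * of_real (snd p)) ^ n * complex_of_real (?g p))
      \<le> norm (2 ^ ?k * ((gauss (1 + \<tau>) (fst p) * \<bar>fst p\<bar> ^ ?k) * gauss (1 - \<tau>) (snd p)
      + gauss (1 + \<tau>) (fst p) * (gauss (1 - \<tau>) (snd p) * \<bar>snd p\<bar> ^ ?k)))"
        unfolding e using F by (simp only: p fst_conv snd_conv)
    qed
  qed measurable
qed

section \<open>Mixed moments of the weight\<close>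

definition cmoment :: "real \<Rightarrow> nat \<Rightarrow> nat \<Rightarrow> complex" where
  "cmoment \<tau> m n = (\<integral>z. z ^ m * cnj z ^ n * of_real (omegaH \<tau> z) \<partial>lborel)"

lemma borel_measurable_omegaH [measurable]: "omegaH \<tau> \<in> borel_measurable borel"
  unfolding omegaH_def by measurable

lemma borel_measurable_cnj [measurable]: "cnj \<in> borel_measurable borel"
  by (intro borel_measurable_continuous_onI continuous_intros)

lemma cmoment_integrable:
  assumes "-1 < \<tau>" "\<tau> < 1"
  shows "integrable lborel (\<lambda>z. z ^ m * cnj z ^ n * of_real (omegaH \<tau> z))"
proof -
  have [measurable]: "(\<lambda>p. complex_of_real (fst p) + \<i> * of_real (snd p)) \<in> lborel \<Otimes>\<^sub>M lborel \<rightarrow>\<^sub>M borel"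
    by measurable
  show ?thesis
    unfolding lborel_complex
    by (subst integrable_distr_eq) (use integrable_monomial_gauss[OF assms, of m n] in \<open>simp_all add: omegaH_eq_gauss assms\<close>)
qed

lemma cmoment_eq_pair:
  assumes "-1 < \<tau>" "\<tau> < 1"
  shows "cmoment \<tau> m n = (\<integral>p. (of_real (fst p) + \<i> * of_real (snd p)) ^ m
     * (of_real (fst p) - \<i> * of_real (snd p)) ^ n
     * complex_of_real (gauss (1 + \<tau>) (fst p) * gauss (1 - \<tau>) (snd p)) \<partial>(lborel \<Otimes>\<^sub>M lborel))"
proof -
  have [measurable]: "(\<lambda>p. complex_of_real (fst p) + \<i> * of_real (snd p)) \<in> lborel \<Otimes>\<^sub>M lborel \<rightarrow>\<^sub>M borel"
    by measurable
  show ?thesis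
    unfolding cmoment_def lborel_complex
    by (subst integral_distr) (simp_all add: omegaH_eq_gauss assms)
qed

text \<open>For fixed y the monomial z^m conj(z)^n is such a product in x, with b = d = 1; for fixed
  x it is one in y, with b = i and d = -i.\<close>

lemma poly_pderiv_linear_powers:
  "poly (pderiv ([:a, b:] ^ m * [:c, d:] ^ n)) x =
    of_nat m * b * ((a + b * x) ^ (m - 1) * (c + d * x) ^ n) + of_nat n * d * ((a + b * x) ^ m * (c + d * x) ^ (n - 1))"
  by (simp add: pderiv_mult pderiv_power pderiv_pCons algebra_simps)

context
  fixes \<tau> :: real
  assumes \<tau>: "-1 < \<tau>" "\<tau> < 1"
begin

definition gauss_weight :: "real \<times> real \<Rightarrow> complex" where
  "gauss_weight p = of_real (gauss (1 + \<tau>) (fst p) * gauss (1 - \<tau>) (snd p))"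

definition bimonomial :: "nat \<Rightarrow> nat \<Rightarrow> real \<times> real \<Rightarrow> complex" where
  "bimonomial m n p = (of_real (fst p) + \<i> * of_real (snd p)) ^ m * (of_real (fst p) - \<i> * of_real (snd p)) ^ n"

lemma integrable_bimonomial: "integrable (lborel \<Otimes>\<^sub>M lborel) (\<lambda>p. bimonomial m n p * gauss_weight p)"
  unfolding bimonomial_def gauss_weight_def by (rule integrable_monomial_gauss[OF \<tau>])

lemma cmoment_bimonomial: "cmoment \<tau> m n = (\<integral>p. bimonomial m n p * gauss_weight p \<partial>(lborel \<Otimes>\<^sub>M lborel))"
  unfolding bimonomial_def gauss_weight_def by (rule cmoment_eq_pair[OF \<tau>])

lemma integrable_fst_bimonomial:
    "integrable (lborel \<Otimes>\<^sub>M lborel) (\<lambda>p. of_real (fst p) * bimonomial m n p * gauss_weight p)"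
  and integrable_snd_bimonomial:
    "integrable (lborel \<Otimes>\<^sub>M lborel) (\<lambda>p. of_real (snd p) * bimonomial m n p * gauss_weight p)"
proof -
  \<comment> \<open>x = (z + conj z)/2 and y = -i (z - conj z)/2, so integrability comes again from
    that of monomials.\<close>
  have "integrable (lborel \<Otimes>\<^sub>M lborel) (\<lambda>p. 1 / 2 * (bimonomial (Suc m) n p * gauss_weight p + bimonomial m (Suc n) p * gauss_weight p))"
    by (intro integrable_mult_right Bochner_Integration.integrable_add integrable_bimonomial)
  moreover have "1 / 2 * (bimonomial (Suc m) n p * gauss_weight p + bimonomial m (Suc n) p * gauss_weight p) = of_real (fst p) * bimonomial m n p * gauss_weight p" for p
    by (simp add: bimonomial_def algebra_simps)
  ultimately show "integrable (lborel \<Otimes>\<^sub>M lborel) (\<lambda>p. of_real (fst p) * bimonomial m n p * gauss_weight p)"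
    by (simp only:)
  have "integrable (lborel \<Otimes>\<^sub>M lborel) (\<lambda>p. - \<i> / 2 * (bimonomial (Suc m) n p * gauss_weight p - bimonomial m (Suc n) p * gauss_weight p))"
    by (intro integrable_mult_right Bochner_Integration.integrable_diff integrable_bimonomial)
  moreover have "- \<i> / 2 * (bimonomial (Suc m) n p * gauss_weight p - bimonomial m (Suc n) p * gauss_weight p) = of_real (snd p) * bimonomial m n p * gauss_weight p" for p
    by (simp add: bimonomial_def algebra_simps)
  ultimately show "integrable (lborel \<Otimes>\<^sub>M lborel) (\<lambda>p. of_real (snd p) * bimonomial m n p * gauss_weight p)"
    by (simp only:)
qed

text \<open>By parts in x for fixed y. Here d/dx treats z and conj z alike, whereas d/dy in
  \<open>integral_snd_bimonomial\<close> brings i and -i.\<close>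

lemma integral_fst_bimonomial:
  "(\<integral>p. of_real (fst p) * bimonomial m n p * gauss_weight p \<partial>(lborel \<Otimes>\<^sub>M lborel))
    = of_real ((1 + \<tau>) / 2) * (of_nat m * cmoment \<tau> (m - 1) n + of_nat n * cmoment \<tau> m (n - 1))"
proof -
  define G where "G = (\<lambda>x y. of_nat m * (bimonomial (m - 1) n (x, y) * gauss_weight (x, y)) + of_nat n * (bimonomial m (n - 1) (x, y) * gauss_weight (x, y)))"
  have G: "integrable (lborel \<Otimes>\<^sub>M lborel) (case_prod G)"
    unfolding G_def case_prod_unfold prod.collapse
    by (intro integrable_mult_right Bochner_Integration.integrable_add integrable_bimonomial)
  have F: "integrable (lborel \<Otimes>\<^sub>M lborel) (\<lambda>(x, y). of_real x * bimonomial m n (x, y) * gauss_weight (x, y))"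
    using integrable_fst_bimonomial[of m n] by (simp only: case_prod_unfold prod.collapse)
  have inner: "(\<integral>x. of_real x * bimonomial m n (x, y) * gauss_weight (x, y) \<partial>lborel) = of_real ((1 + \<tau>) / 2) * (\<integral>x. G x y \<partial>lborel)" for y
  proof -
    let ?P = "[:\<i> * of_real y, 1:] ^ m * [:- \<i> * of_real y, 1:] ^ n"
    have "(\<integral>x. of_real x * bimonomial m n (x, y) * gauss_weight (x, y) \<partial>lborel)
       = (\<integral>x. (of_real x * poly ?P (of_real x) * of_real (gauss (1 + \<tau>) x)) * of_real (gauss (1 - \<tau>) y) \<partial>lborel)"
      by (intro Bochner_Integration.integral_cong refl) (simp add: bimonomial_def gauss_weight_def algebra_simps)
    also have "\<dots> = of_real ((1 + \<tau>) / 2) *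
        (\<integral>x. poly (pderiv ?P) (of_real x) * of_real (gauss (1 + \<tau>) x) \<partial>lborel) * of_real (gauss (1 - \<tau>) y)"
      using gauss_by_parts[of "1 + \<tau>" ?P] \<tau> by (simp only: integral_mult_left_zero)
    also have "\<dots> = of_real ((1 + \<tau>) / 2) *
        (\<integral>x. (poly (pderiv ?P) (of_real x) * of_real (gauss (1 + \<tau>) x)) * of_real (gauss (1 - \<tau>) y) \<partial>lborel)"
      unfolding integral_mult_left_zero by (simp only: mult.assoc)
    also have "(\<integral>x. (poly (pderiv ?P) (of_real x) * of_real (gauss (1 + \<tau>) x)) * of_real (gauss (1 - \<tau>) y) \<partial>lborel)
        = (\<integral>x. G x y \<partial>lborel)"
      by (intro Bochner_Integration.integral_cong refl)
         (simp add: poly_pderiv_linear_powers G_def bimonomial_def gauss_weight_def algebra_simps)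
    finally show ?thesis .
  qed
  have "(\<integral>p. of_real (fst p) * bimonomial m n p * gauss_weight p \<partial>(lborel \<Otimes>\<^sub>M lborel))
      = (\<integral>y. (\<integral>x. of_real x * bimonomial m n (x, y) * gauss_weight (x, y) \<partial>lborel) \<partial>lborel)"
    using lborel_pair.integral_snd[OF F] by (simp only: case_prod_unfold prod.collapse)
  also have "\<dots> = of_real ((1 + \<tau>) / 2) * (\<integral>y. (\<integral>x. G x y \<partial>lborel) \<partial>lborel)"
    unfolding inner by (rule integral_mult_right_zero)
  also have "(\<integral>y. (\<integral>x. G x y \<partial>lborel) \<partial>lborel) = (\<integral>p. case_prod G p \<partial>(lborel \<Otimes>\<^sub>M lborel))"
    by (rule lborel_pair.integral_snd[OF G])
  also have "\<dots> = of_nat m * cmoment \<tau> (m - 1) n + of_nat n * cmoment \<tau> m (n - 1)"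
    unfolding G_def case_prod_unfold prod.collapse cmoment_bimonomial
    by (simp only: Bochner_Integration.integral_add integrable_mult_right integrable_bimonomial integral_mult_right_zero)
  finally show ?thesis .
qed

lemma integral_snd_bimonomial:
  "(\<integral>p. of_real (snd p) * bimonomial m n p * gauss_weight p \<partial>(lborel \<Otimes>\<^sub>M lborel))
    = of_real ((1 - \<tau>) / 2) * (of_nat m * \<i> * cmoment \<tau> (m - 1) n + of_nat n * (- \<i>) * cmoment \<tau> m (n - 1))"
proof -
  define G where "G = (\<lambda>x y. of_nat m * \<i> * (bimonomial (m - 1) n (x, y) * gauss_weight (x, y)) + of_nat n * (- \<i>) * (bimonomial m (n - 1) (x, y) * gauss_weight (x, y)))"
  have G: "integrable (lborel \<Otimes>\<^sub>M lborel) (case_prod G)"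
    unfolding G_def case_prod_unfold prod.collapse
    by (intro integrable_mult_right Bochner_Integration.integrable_add integrable_bimonomial)
  have F: "integrable (lborel \<Otimes>\<^sub>M lborel) (\<lambda>(x, y). of_real y * bimonomial m n (x, y) * gauss_weight (x, y))"
    using integrable_snd_bimonomial[of m n] by (simp only: case_prod_unfold prod.collapse)
  have inner: "(\<integral>y. of_real y * bimonomial m n (x, y) * gauss_weight (x, y) \<partial>lborel) = of_real ((1 - \<tau>) / 2) * (\<integral>y. G x y \<partial>lborel)" for x
  proof -
    let ?P = "[:of_real x, \<i>:] ^ m * [:of_real x, - \<i>:] ^ n"
    have "(\<integral>y. of_real y * bimonomial m n (x, y) * gauss_weight (x, y) \<partial>lborel)
       = (\<integral>y. (of_real y * poly ?P (of_real y) * of_real (gauss (1 - \<tau>) y)) * of_real (gauss (1 + \<tau>) x) \<partial>lborel)"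
      by (intro Bochner_Integration.integral_cong refl) (simp add: bimonomial_def gauss_weight_def algebra_simps)
    also have "\<dots> = of_real ((1 - \<tau>) / 2) *
        (\<integral>y. poly (pderiv ?P) (of_real y) * of_real (gauss (1 - \<tau>) y) \<partial>lborel) * of_real (gauss (1 + \<tau>) x)"
      using gauss_by_parts[of "1 - \<tau>" ?P] \<tau> by (simp only: integral_mult_left_zero)
    also have "\<dots> = of_real ((1 - \<tau>) / 2) *
        (\<integral>y. (poly (pderiv ?P) (of_real y) * of_real (gauss (1 - \<tau>) y)) * of_real (gauss (1 + \<tau>) x) \<partial>lborel)"
      unfolding integral_mult_left_zero by (simp only: mult.assoc)
    also have "(\<integral>y. (poly (pderiv ?P) (of_real y) * of_real (gauss (1 - \<tau>) y)) * of_real (gauss (1 + \<tau>) x) \<partial>lborel)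
        = (\<integral>y. G x y \<partial>lborel)"
      by (intro Bochner_Integration.integral_cong refl)
         (simp add: poly_pderiv_linear_powers G_def bimonomial_def gauss_weight_def algebra_simps)
    finally show ?thesis .
  qed
  have "(\<integral>p. of_real (snd p) * bimonomial m n p * gauss_weight p \<partial>(lborel \<Otimes>\<^sub>M lborel))
      = (\<integral>x. (\<integral>y. of_real y * bimonomial m n (x, y) * gauss_weight (x, y) \<partial>lborel) \<partial>lborel)"
    using lborel_pair.integral_fst[OF F] by (simp only: case_prod_unfold prod.collapse)
  also have "\<dots> = of_real ((1 - \<tau>) / 2) * (\<integral>x. (\<integral>y. G x y \<partial>lborel) \<partial>lborel)"
    unfolding inner by (rule integral_mult_right_zero)
  also have "(\<integral>x. (\<integral>y. G x y \<partial>lborel) \<partial>lborel) = (\<integral>p. case_prod G p \<partial>(lborel \<Otimes>\<^sub>M lborel))"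
    by (rule lborel_pair.integral_fst[OF G])
  also have "\<dots> = of_nat m * \<i> * cmoment \<tau> (m - 1) n + of_nat n * (- \<i>) * cmoment \<tau> m (n - 1)"
    unfolding G_def case_prod_unfold prod.collapse cmoment_bimonomial
    by (simp only: Bochner_Integration.integral_add integrable_mult_right integrable_bimonomial integral_mult_right_zero)
  finally show ?thesis .
qed

text \<open>With z = x + iy, lowering z gets the coefficient (1 + tau)/2 - (1 - tau)/2 = tau,
  lowering conj z gets (1 + tau)/2 + (1 - tau)/2 = 1.\<close>

lemma cmoment_Suc_left:
  "cmoment \<tau> (Suc m) n = of_real \<tau> * of_nat m * cmoment \<tau> (m - 1) n + of_nat n * cmoment \<tau> m (n - 1)"
proof -
  have e: "bimonomial (Suc m) n p * gauss_weight p = of_real (fst p) * bimonomial m n p * gauss_weight p + \<i> * (of_real (snd p) * bimonomial m n p * gauss_weight p)" for p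
    by (simp add: bimonomial_def algebra_simps)
  have "cmoment \<tau> (Suc m) n = (\<integral>p. of_real (fst p) * bimonomial m n p * gauss_weight p \<partial>(lborel \<Otimes>\<^sub>M lborel))
      + \<i> * (\<integral>p. of_real (snd p) * bimonomial m n p * gauss_weight p \<partial>(lborel \<Otimes>\<^sub>M lborel))"
    unfolding cmoment_bimonomial e
    by (simp only: Bochner_Integration.integral_add integrable_mult_right integrable_fst_bimonomial integrable_snd_bimonomial integral_mult_right_zero)
  moreover have "of_real ((1 + \<tau>) / 2) * (A + B) + \<i> * (of_real ((1 - \<tau>) / 2) * (of_nat m * \<i> * a + of_nat n * (- \<i>) * b))
      = of_real \<tau> * A + B" if "A = of_nat m * a" "B = of_nat n * b" for A B a b
    unfolding that by (simp add: field_simps)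
  ultimately show ?thesis unfolding integral_fst_bimonomial integral_snd_bimonomial by (simp only: mult.assoc)
qed

lemma cmoment_Suc_right:
  "cmoment \<tau> m (Suc n) = of_real \<tau> * of_nat n * cmoment \<tau> m (n - 1) + of_nat m * cmoment \<tau> (m - 1) n"
proof -
  have e: "bimonomial m (Suc n) p * gauss_weight p = of_real (fst p) * bimonomial m n p * gauss_weight p + (- \<i>) * (of_real (snd p) * bimonomial m n p * gauss_weight p)" for p
    by (simp add: bimonomial_def algebra_simps)
  have "cmoment \<tau> m (Suc n) = (\<integral>p. of_real (fst p) * bimonomial m n p * gauss_weight p \<partial>(lborel \<Otimes>\<^sub>M lborel))
      + (- \<i>) * (\<integral>p. of_real (snd p) * bimonomial m n p * gauss_weight p \<partial>(lborel \<Otimes>\<^sub>M lborel))"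
    unfolding cmoment_bimonomial e
    by (simp only: Bochner_Integration.integral_add integrable_mult_right integrable_fst_bimonomial integrable_snd_bimonomial integral_mult_right_zero)
  moreover have "of_real ((1 + \<tau>) / 2) * (A + B) + (- \<i>) * (of_real ((1 - \<tau>) / 2) * (of_nat m * \<i> * a + of_nat n * (- \<i>) * b))
      = of_real \<tau> * B + A" if "A = of_nat m * a" "B = of_nat n * b" for A B a b
    unfolding that by (simp add: field_simps)
  ultimately show ?thesis unfolding integral_fst_bimonomial integral_snd_bimonomial by (simp only: mult.assoc)
qed

section \<open>The pairing of polynomials given by the weight\<close>

definition omega_pairing :: "complex poly \<Rightarrow> complex poly \<Rightarrow> complex" where
  "omega_pairing f g = (\<integral>z. poly f z * poly g (cnj z) * of_real (omegaH \<tau> z) \<partial>lborel)"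

lemma omega_pairing_integrable: "integrable lborel (\<lambda>z. poly f z * poly g (cnj z) * of_real (omegaH \<tau> z))"
proof (induction f rule: poly_monom_induct)
  case (1 a m)
  show ?case
  proof (induction g rule: poly_monom_induct)
    case (1 b n)
    have "integrable lborel (\<lambda>z. a * b * (z ^ m * cnj z ^ n * of_real (omegaH \<tau> z)))"
      by (intro integrable_mult_right cmoment_integrable \<tau>)
    then show ?case by (simp add: poly_monom mult_ac)
  qed (simp add: distrib_left distrib_right)
qed (simp add: distrib_left distrib_right)

lemma omega_pairing_add_left: "omega_pairing (f + f') g = omega_pairing f g + omega_pairing f' g"
  unfolding omega_pairing_def by (simp add: distrib_right omega_pairing_integrable)

lemma omega_pairing_add_right: "omega_pairing f (g + g') = omega_pairing f g + omega_pairing f g'"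
  unfolding omega_pairing_def by (simp add: distrib_left distrib_right omega_pairing_integrable)

lemma omega_pairing_monom: "omega_pairing (monom a m) (monom b n) = a * b * cmoment \<tau> m n"
proof -
  have "omega_pairing (monom a m) (monom b n) = (\<integral>z. a * b * (z ^ m * cnj z ^ n * of_real (omegaH \<tau> z)) \<partial>lborel)"
    unfolding omega_pairing_def by (intro Bochner_Integration.integral_cong refl) (simp add: poly_monom mult_ac)
  then show ?thesis by (simp add: cmoment_def)
qed

text \<open>By linearity in both slots the shift rules need checking on monomials only, where they
  are the recursions for \<open>cmoment\<close>.\<close>

lemma omega_pairing_hermite: "hermite_pairing (of_real \<tau>) (omega_pairing 1 1) omega_pairing"
proof
  fix c f g
  show "omega_pairing (smult c f) g = c * omega_pairing f g" "omega_pairing f (smult c g) = c * omega_pairing f g"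
    unfolding omega_pairing_def poly_smult by (simp_all only: mult.assoc mult.left_commute[of _ c] integral_mult_right_zero)
next
  fix f g
  have p: "pCons 0 (monom a m) = monom a (Suc m)" for a :: complex and m by (simp add: monom_Suc)
  show "omega_pairing (pCons 0 f) g = of_real \<tau> * omega_pairing (pderiv f) g + omega_pairing f (pderiv g)"
  proof (induction f rule: poly_monom_induct)
    case (1 a m)
    show ?case
    proof (induction g rule: poly_monom_induct)
      case (1 b n)
      show ?case unfolding p pderiv_monom omega_pairing_monom cmoment_Suc_left by (simp add: algebra_simps)
    qed (simp add: omega_pairing_add_right pderiv_add algebra_simps)
  next
    case (2 f f')
    have "pCons 0 (f + f') = pCons 0 f + pCons 0 f'" by simp
    then show ?case using 2 by (simp only: omega_pairing_add_left pderiv_add distrib_left add_ac)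
  qed
  show "omega_pairing f (pCons 0 g) = of_real \<tau> * omega_pairing f (pderiv g) + omega_pairing (pderiv f) g"
  proof (induction f rule: poly_monom_induct)
    case (1 a m)
    show ?case
    proof (induction g rule: poly_monom_induct)
      case (1 b n)
      show ?case unfolding p pderiv_monom omega_pairing_monom cmoment_Suc_right by (simp add: algebra_simps)
    next
      case (2 g g')
      have "pCons 0 (g + g') = pCons 0 g + pCons 0 g'" by simp
      then show ?case using 2 by (simp only: omega_pairing_add_right pderiv_add distrib_left add_ac)
    qed
  qed (simp add: omega_pairing_add_left pderiv_add algebra_simps)
qed (simp_all add: omega_pairing_add_left omega_pairing_add_right)

lemma omega_pairing_one_nonzero: "omega_pairing 1 1 \<noteq> 0"
proof
  assume "omega_pairing 1 1 = 0"
  then have "(\<integral>z. omegaH \<tau> z \<partial>lborel) = 0" by (simp add: omega_pairing_def)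
  moreover have "integrable lborel (omegaH \<tau>)"
    using omega_pairing_integrable[of 1 1] by (simp add: complex_of_real_integrable_eq)
  moreover have pos: "omegaH \<tau> z > 0" for z by (simp add: omegaH_def)
  ultimately have "AE z in lborel. omegaH \<tau> z = 0"
    by (subst (asm) integral_nonneg_eq_0_iff_AE) (auto intro: less_imp_le)
  then have "AE z in (lborel :: complex measure). False"
    by eventually_elim (use pos in \<open>metis less_irrefl\<close>)
  then have "ae_filter (lborel :: complex measure) = bot" by (simp add: trivial_limit_def)
  then show False by (simp add: ae_filter_eq_bot_iff)
qed

end

section \<open>One-point functions\<close>

text \<open>Every summand of the density factorises over the points, so inserting F at the point j
  changes only the j-th factor of the product of integrals; psi carries that change.\<close>

lemma one_point_integrals:
  fixes \<phi> :: "'s \<Rightarrow> nat \<Rightarrow> complex \<Rightarrow> complex" and F :: "complex \<Rightarrow> complex"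
  assumes \<phi>: "\<And>s j. integrable lborel (\<phi> s j)"
    and F\<phi>: "\<And>s j. integrable lborel (\<lambda>z. F z * \<phi> s j z)"
    and D: "\<And>z. D z = (\<Sum>s\<in>S. c s * (\<Prod>j<n. \<phi> s j (z j)))"
  shows "integrable (confM n) D"
    and "(\<integral>z. D z \<partial>confM n) = (\<Sum>s\<in>S. c s * (\<Prod>j<n. \<integral>z. \<phi> s j z \<partial>lborel))"
    and "(\<integral>z. (\<Sum>j<n. F (z j)) * D z \<partial>confM n) =
      (\<Sum>s\<in>S. c s * (\<Sum>j<n. (\<integral>z. F z * \<phi> s j z \<partial>lborel) * (\<Prod>i\<in>{..<n} - {j}. \<integral>z. \<phi> s i z \<partial>lborel)))"
proof -
  interpret product_sigma_finite "\<lambda>_::nat. lborel :: complex measure" by unfold_locales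
  have prod: "integrable (confM n) (\<lambda>z. \<Prod>j<n. \<phi> s j (z j))" for s
    by (intro product_integrable_prod) (auto intro: \<phi>)
  show "integrable (confM n) D"
    unfolding D by (intro Bochner_Integration.integrable_sum integrable_mult_right prod)
  have "(\<integral>z. D z \<partial>confM n) = (\<Sum>s\<in>S. c s * (\<integral>z. (\<Prod>j<n. \<phi> s j (z j)) \<partial>confM n))"
    unfolding D by (subst Bochner_Integration.integral_sum) (auto intro: integrable_mult_right prod)
  also have "\<dots> = (\<Sum>s\<in>S. c s * (\<Prod>j<n. \<integral>z. \<phi> s j z \<partial>lborel))"
    by (intro sum.cong refl arg_cong2[of _ _ _ _ "(*)"] product_integral_prod) (auto intro: \<phi>)
  finally show "(\<integral>z. D z \<partial>confM n) = (\<Sum>s\<in>S. c s * (\<Prod>j<n. \<integral>z. \<phi> s j z \<partial>lborel))" .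
  define \<psi> where "\<psi> = (\<lambda>s j i z. if i = j then F z * \<phi> s i z else \<phi> s i z)"
  have \<psi>: "integrable lborel (\<psi> s j i)" for s j i
    unfolding \<psi>_def using \<phi>[of s i] F\<phi>[of s i] by (cases "i = j") auto
  have prod\<psi>: "integrable (confM n) (\<lambda>z. \<Prod>i<n. \<psi> s j i (z i))" for s j
    by (intro product_integrable_prod) (auto intro: \<psi>)
  have e: "F (z j) * (\<Prod>i<n. \<phi> s i (z i)) = (\<Prod>i<n. \<psi> s j i (z i))" if "j < n" for s j z
  proof -
    have "(\<Prod>i<n. \<psi> s j i (z i)) = \<psi> s j j (z j) * (\<Prod>i\<in>{..<n} - {j}. \<psi> s j i (z i))"
      using that by (intro prod.remove) auto
    also have "(\<Prod>i\<in>{..<n} - {j}. \<psi> s j i (z i)) = (\<Prod>i\<in>{..<n} - {j}. \<phi> s i (z i))"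
      by (intro prod.cong) (auto simp: \<psi>_def)
    also have "\<psi> s j j (z j) * \<dots> = F (z j) * (\<phi> s j (z j) * (\<Prod>i\<in>{..<n} - {j}. \<phi> s i (z i)))"
      by (simp add: \<psi>_def)
    also have "\<phi> s j (z j) * (\<Prod>i\<in>{..<n} - {j}. \<phi> s i (z i)) = (\<Prod>i<n. \<phi> s i (z i))"
      using that by (intro prod.remove[symmetric]) auto
    finally show ?thesis by simp
  qed
  have "(\<Sum>j<n. F (z j)) * D z = (\<Sum>s\<in>S. c s * (\<Sum>j<n. \<Prod>i<n. \<psi> s j i (z i)))" for z
  proof -
    have "(\<Sum>j<n. F (z j)) * D z = (\<Sum>s\<in>S. c s * ((\<Sum>j<n. F (z j)) * (\<Prod>j<n. \<phi> s j (z j))))"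
      unfolding D sum_distrib_left[of _ _ S] by (intro sum.cong refl) (simp only: mult_ac)
    also have "\<dots> = (\<Sum>s\<in>S. c s * (\<Sum>j<n. \<Prod>i<n. \<psi> s j i (z i)))"
      unfolding sum_distrib_right
      by (intro sum.cong refl arg_cong2[of _ _ _ _ "(*)"]) (simp_all only: e lessThan_iff)
    finally show ?thesis .
  qed
  then have "(\<integral>z. (\<Sum>j<n. F (z j)) * D z \<partial>confM n)
      = (\<integral>z. (\<Sum>s\<in>S. c s * (\<Sum>j<n. \<Prod>i<n. \<psi> s j i (z i))) \<partial>confM n)"
    by (simp only:)
  also have "\<dots> = (\<Sum>s\<in>S. c s * (\<integral>z. (\<Sum>j<n. \<Prod>i<n. \<psi> s j i (z i)) \<partial>confM n))"
    by (subst Bochner_Integration.integral_sum)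
       (auto intro!: integrable_mult_right Bochner_Integration.integrable_sum prod\<psi>)
  also have "\<dots> = (\<Sum>s\<in>S. c s * (\<Sum>j<n. \<integral>z. (\<Prod>i<n. \<psi> s j i (z i)) \<partial>confM n))"
    by (subst Bochner_Integration.integral_sum) (auto intro: prod\<psi>)
  also have "\<dots> = (\<Sum>s\<in>S. c s * (\<Sum>j<n. \<Prod>i<n. \<integral>z. \<psi> s j i z \<partial>lborel))"
    by (intro sum.cong refl arg_cong2[of _ _ _ _ "(*)"] product_integral_prod) (auto intro: \<psi>)
  also have "\<dots> = (\<Sum>s\<in>S. c s * (\<Sum>j<n. (\<integral>z. F z * \<phi> s j z \<partial>lborel) * (\<Prod>i\<in>{..<n} - {j}. \<integral>z. \<phi> s i z \<partial>lborel)))"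
  proof (intro sum.cong refl arg_cong2[of _ _ _ _ "(*)"])
    fix s j assume j: "j \<in> {..<n}"
    have "(\<Prod>i<n. \<integral>z. \<psi> s j i z \<partial>lborel) = (\<integral>z. \<psi> s j j z \<partial>lborel) * (\<Prod>i\<in>{..<n} - {j}. \<integral>z. \<psi> s j i z \<partial>lborel)"
      using j by (intro prod.remove) auto
    also have "(\<Prod>i\<in>{..<n} - {j}. \<integral>z. \<psi> s j i z \<partial>lborel) = (\<Prod>i\<in>{..<n} - {j}. \<integral>z. \<phi> s i z \<partial>lborel)"
      by (intro prod.cong) (auto simp: \<psi>_def)
    finally show "(\<Prod>i<n. \<integral>z. \<psi> s j i z \<partial>lborel) = (\<integral>z. F z * \<phi> s j z \<partial>lborel) * (\<Prod>i\<in>{..<n} - {j}. \<integral>z. \<phi> s i z \<partial>lborel)"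
      by (simp add: \<psi>_def)
  qed
  finally show "(\<integral>z. (\<Sum>j<n. F (z j)) * D z \<partial>confM n) =
      (\<Sum>s\<in>S. c s * (\<Sum>j<n. (\<integral>z. F z * \<phi> s j z \<partial>lborel) * (\<Prod>i\<in>{..<n} - {j}. \<integral>z. \<phi> s i z \<partial>lborel)))" .
qed

text \<open>The normalisation is never evaluated, only shown to be nonzero. Real parts in disjoint
  intervals and positive imaginary parts keep all z_j - z_k, z_j - conj z_k and z_j - conj z_j away
  from 0, and these configurations contain a product of unit boxes.\<close>

lemma integral_density_nonzero:
  fixes w :: "(nat \<Rightarrow> complex) \<Rightarrow> real"
  assumes "integrable (confM n) w" and nonneg: "\<And>z. w z \<ge> 0"
    and pos: "\<And>z. (\<And>j. j < n \<Longrightarrow> 2 * real j < Re (z j) \<and> Re (z j) < 2 * real j + 1 \<and> Im (z j) > 0) \<Longrightarrow> w z > 0"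
  shows "(\<integral>z. w z \<partial>confM n) \<noteq> 0"
proof
  interpret product_sigma_finite "\<lambda>_::nat. lborel :: complex measure" by unfold_locales
  assume "(\<integral>z. w z \<partial>confM n) = 0"
  then have AE: "AE z in confM n. w z = 0"
    using integral_nonneg_eq_0_iff_AE[OF assms(1)] nonneg by simp
  define A where "A = (\<lambda>j. box (Complex (2 * real j) 0) (Complex (2 * real j + 1) 1))"
  have "AE z in confM n. z \<notin> Pi\<^sub>E {..<n} A"
    using AE
  proof eventually_elim
    case (elim z)
    show ?case
    proof
      assume "z \<in> Pi\<^sub>E {..<n} A"
      then have "w z > 0" by (intro pos) (auto simp: PiE_iff A_def in_box_complex_iff)
      then show False using elim by simp
    qed
  qed
  moreover have "Pi\<^sub>E {..<n} A \<in> sets (confM n)"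
    by (intro sets_PiM_I_finite) (auto simp: A_def)
  ultimately have "emeasure (confM n) (Pi\<^sub>E {..<n} A) = 0"
    using AE_iff_measurable[of "Pi\<^sub>E {..<n} A" "confM n" "\<lambda>z. z \<notin> Pi\<^sub>E {..<n} A"]
      sets.sets_into_space[of "Pi\<^sub>E {..<n} A" "confM n"] by auto
  moreover have "emeasure (confM n) (Pi\<^sub>E {..<n} A) = (\<Prod>j<n. emeasure lborel (A j))"
    by (rule emeasure_PiM) (auto simp: A_def)
  moreover have "emeasure lborel (A j) = 1" for j
    by (simp add: A_def emeasure_lborel_box_eq Basis_complex_def)
  ultimately show False by simp
qed

lemma omegaH_pos: "omegaH \<tau> z > 0" by (simp add: omegaH_def)

lemma expect_eq:
  assumes D: "complex_of_real (\<integral>z. w z \<partial>confM n) \<noteq> 0"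
    and num: "(\<integral>z. f z * complex_of_real (w z) \<partial>confM n) = K * (\<integral>z. complex_of_real (w z) \<partial>confM n)"
  shows "expect n w f = K"
  using D unfolding expect_def num integral_complex_of_real by simp

context
  fixes \<tau> :: real
  assumes \<tau>: "-1 < \<tau>" "\<tau> < 1"
begin

interpretation hermite_pairing "complex_of_real \<tau>" "omega_pairing \<tau> 1 1" "omega_pairing \<tau>"
  by (rule omega_pairing_hermite[OF \<tau>])

lemma MC_eq_sum:
  "MC \<tau> p1 p2 n = (\<Sum>k<n. omega_pairing \<tau> (monom 1 p1 * herm (of_real \<tau>) k) (monom 1 p2 * herm (of_real \<tau>) k) / (omega_pairing \<tau> 1 1 * fact k))"
proof -
  let ?h = "omega_pairing \<tau> 1 1" and ?p = "herm (complex_of_real \<tau>)"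
  let ?P = "{\<sigma>. \<sigma> permutes {..<n}}"
  define F where "F = (\<lambda>z. z ^ p1 * cnj z ^ p2)"
  define \<phi> where "\<phi> = (\<lambda>(\<sigma> :: nat \<Rightarrow> nat, \<rho> :: nat \<Rightarrow> nat) (j :: nat) z. poly (?p (\<sigma> j)) z * poly (?p (\<rho> j)) (cnj z) * of_real (omegaH \<tau> z) :: complex)"
  define c where "c = (\<lambda>(\<sigma> :: nat \<Rightarrow> nat, \<rho> :: nat \<Rightarrow> nat). of_int (sign \<sigma> * sign \<rho>) :: complex)"
  have F\<phi>: "F z * \<phi> (\<sigma>, \<rho>) j z = poly (monom 1 p1 * ?p (\<sigma> j)) z * poly (monom 1 p2 * ?p (\<rho> j)) (cnj z) * of_real (omegaH \<tau> z)" for z \<sigma> \<rho> j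
    by (simp add: F_def \<phi>_def poly_monom mult_ac)
  have D: "complex_of_real (densC \<tau> n z) = (\<Sum>s\<in>?P \<times> ?P. c s * (\<Prod>j<n. \<phi> s j (z j)))" for z
    unfolding densC_expansion[OF herm_degree_lead[of "of_real \<tau>"]] by (intro sum.cong refl) (auto simp: c_def \<phi>_def)
  have i1: "integrable lborel (\<phi> s j)" for s j
    by (cases s) (simp add: \<phi>_def omega_pairing_integrable[OF \<tau>])
  have i2: "integrable lborel (\<lambda>z. F z * \<phi> s j z)" for s j
    by (cases s) (simp only: F\<phi> omega_pairing_integrable[OF \<tau>])
  note opi = one_point_integrals[OF i1 i2 D]
  define a where "a = (\<lambda>i j. omega_pairing \<tau> (?p i) (?p j))"
  define b where "b = (\<lambda>i j. omega_pairing \<tau> (monom 1 p1 * ?p i) (monom 1 p2 * ?p j))"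
  have a0: "a i j = 0 \<longleftrightarrow> i \<noteq> j" for i j
    unfolding a_def herm_orth using omega_pairing_one_nonzero[OF \<tau>] by simp
  have I1: "(\<integral>z. \<phi> (\<sigma>, \<rho>) j z \<partial>lborel) = a (\<sigma> j) (\<rho> j)" for \<sigma> \<rho> j
    by (simp add: \<phi>_def a_def omega_pairing_def[OF \<tau>])
  have I2: "(\<integral>z. F z * \<phi> (\<sigma>, \<rho>) j z \<partial>lborel) = b (\<sigma> j) (\<rho> j)" for \<sigma> \<rho> j
    unfolding F\<phi> b_def omega_pairing_def[OF \<tau>] ..
  have "(\<integral>z. (\<Sum>j<n. F (z j)) * complex_of_real (densC \<tau> n z) \<partial>confM n)
     = (\<Sum>(\<sigma>, \<rho>)\<in>?P \<times> ?P. c (\<sigma>, \<rho>) * (\<Sum>j<n. b (\<sigma> j) (\<rho> j) * (\<Prod>i\<in>{..<n} - {j}. a (\<sigma> i) (\<rho> i))))"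
    unfolding opi(3) by (intro sum.cong refl) (auto simp: I1 I2)
  also have "\<dots> = (\<Sum>(\<sigma>, \<rho>)\<in>?P \<times> ?P. (\<Sum>k<n. b k k / a k k) * (c (\<sigma>, \<rho>) * (\<Prod>i<n. a (\<sigma> i) (\<rho> i))))"
  proof (intro sum.cong refl, clarify)
    fix \<sigma> \<rho> assume "\<sigma> permutes {..<n}" "\<rho> permutes {..<n}"
    from insertion_sum_diagonal[OF this a0, of b]
    show "c (\<sigma>, \<rho>) * (\<Sum>j<n. b (\<sigma> j) (\<rho> j) * (\<Prod>i\<in>{..<n} - {j}. a (\<sigma> i) (\<rho> i)))
      = (\<Sum>k<n. b k k / a k k) * (c (\<sigma>, \<rho>) * (\<Prod>i<n. a (\<sigma> i) (\<rho> i)))"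
      by (simp only: mult.left_commute)
  qed
  also have "\<dots> = (\<Sum>k<n. b k k / a k k) * (\<integral>z. complex_of_real (densC \<tau> n z) \<partial>confM n)"
    unfolding opi(2) sum_distrib_left by (intro sum.cong refl) (auto simp: I1)
  finally have num: "(\<integral>z. momentFn p1 p2 n z * complex_of_real (densC \<tau> n z) \<partial>confM n)
      = (\<Sum>k<n. b k k / a k k) * (\<integral>z. complex_of_real (densC \<tau> n z) \<partial>confM n)"
    unfolding momentFn_def F_def .
  have "(\<integral>z. densC \<tau> n z \<partial>confM n) \<noteq> 0"
  proof (rule integral_density_nonzero)
    show "integrable (confM n) (densC \<tau> n)" using opi(1) by (simp only: complex_of_real_integrable_eq)
    show "densC \<tau> n z \<ge> 0" for z
      unfolding densC_def by (intro mult_nonneg_nonneg prod_nonneg ballI zero_le_power2 less_imp_le[OF omegaH_pos])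
    fix z :: "nat \<Rightarrow> complex"
    assume z: "\<And>j. j < n \<Longrightarrow> 2 * real j < Re (z j) \<and> Re (z j) < 2 * real j + 1 \<and> Im (z j) > 0"
    have "z j \<noteq> z k" if "j < k" "k < n" for j k
      using z[of j] z[of k] that by auto
    then show "densC \<tau> n z > 0"
      unfolding densC_def by (intro mult_pos_pos prod_pos ballI) (auto simp: omegaH_pos)
  qed
  then have "MC \<tau> p1 p2 n = (\<Sum>k<n. b k k / a k k)"
    unfolding MC_def by (intro expect_eq num) simp
  then show ?thesis by (simp add: a_def b_def herm_orth)
qed

text \<open>The inserted form is not a multiple of \<open>skew\<close>, but on each pair of siblings
  its antisymmetric part is, and the ratio is the k-th summand.\<close>

lemma MH_eq_sum: "MH \<tau> p1 p2 n = (\<Sum>k<n. symplectic_term p1 p2 k) / omega_pairing \<tau> 1 1"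
proof -
  let ?h = "omega_pairing \<tau> 1 1" and ?P = "{\<sigma>. \<sigma> permutes {..<2 * n}}"
  define F where "F = (\<lambda>z. z ^ p1 * cnj z ^ p2)"
  define \<phi> where "\<phi> = (\<lambda>(\<sigma> :: nat \<Rightarrow> nat) (j :: nat) z. poly (skew_poly (\<sigma> (2*j))) z * poly (skew_poly (\<sigma> (2*j+1))) (cnj z) * (z - cnj z) * of_real (omegaH \<tau> z) :: complex)"
  define c where "c = (\<lambda>\<sigma> :: nat \<Rightarrow> nat. of_int (sign \<sigma>) :: complex)"
  have \<phi>: "\<phi> \<sigma> j z = poly (pCons 0 (skew_poly (\<sigma> (2*j)))) z * poly (skew_poly (\<sigma> (2*j+1))) (cnj z) * of_real (omegaH \<tau> z)
      - poly (skew_poly (\<sigma> (2*j))) z * poly (pCons 0 (skew_poly (\<sigma> (2*j+1)))) (cnj z) * of_real (omegaH \<tau> z)" for \<sigma> j z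
    by (simp add: \<phi>_def algebra_simps)
  have F\<phi>: "F z * \<phi> \<sigma> j z = poly (monom 1 (Suc p1) * skew_poly (\<sigma> (2*j))) z * poly (monom 1 p2 * skew_poly (\<sigma> (2*j+1))) (cnj z) * of_real (omegaH \<tau> z)
      - poly (monom 1 p1 * skew_poly (\<sigma> (2*j))) z * poly (monom 1 (Suc p2) * skew_poly (\<sigma> (2*j+1))) (cnj z) * of_real (omegaH \<tau> z)" for \<sigma> j z
    by (simp add: \<phi>_def F_def poly_monom algebra_simps)
  have D: "complex_of_real (densH \<tau> n z) = (\<Sum>\<sigma>\<in>?P. c \<sigma> * (\<Prod>j<n. \<phi> \<sigma> j (z j)))" for z
    unfolding densH_expansion[OF skew_poly_degree_lead] c_def \<phi>_def ..
  have i1: "integrable lborel (\<phi> s j)" for s j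
    unfolding \<phi> by (intro Bochner_Integration.integrable_diff omega_pairing_integrable[OF \<tau>])
  have i2: "integrable lborel (\<lambda>z. F z * \<phi> s j z)" for s j
    unfolding F\<phi> by (intro Bochner_Integration.integrable_diff omega_pairing_integrable[OF \<tau>])
  note opi = one_point_integrals[OF i1 i2 D]
  define a where "a = (\<lambda>i j. skew (skew_poly i) (skew_poly j))"
  \<comment> \<open>The minus sign turns the weight conj z - z of \<open>insertion\<close> into the
    z - conj z of the density.\<close>
  define b where "b = (\<lambda>i j. - insertion p1 p2 (skew_poly i) (skew_poly j))"
  define b' where "b' = (\<lambda>i j. (b i j - b j i) / 2)"
  define r where "r = (\<lambda>k. symplectic_term p1 p2 k / ?h)"
  have nz: "?h \<noteq> 0" "1 - complex_of_real \<tau> \<noteq> 0"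
    using omega_pairing_one_nonzero[OF \<tau>] \<tau> by simp_all
  have a0: "a i j = 0 \<longleftrightarrow> j \<noteq> sibling i" for i j
    unfolding a_def skew_skew_poly sibling_def using nz by (auto simp: odd_pos simp del: fact_Suc)
  \<comment> \<open>Both forms change sign when 2k and 2k + 1 are exchanged, so their ratio depends
    on the pair only.\<close>
  have ab: "b' i (sibling i) = r (i div 2) * a i (sibling i)" for i
  proof -
    obtain k where k: "i = 2 * k \<or> i = Suc (2 * k)" by (metis evenE oddE Suc_eq_plus1)
    define f :: complex where "f = fact (2 * k + 1)"
    define u where "u = 1 - complex_of_real \<tau>"
    define x where "x = insertion p1 p2 (herm (of_real \<tau>) (2 * k + 1)) (even_skew_poly k) - insertion p1 p2 (even_skew_poly k) (herm (of_real \<tau>) (2 * k + 1))"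
    have qp: "skew_poly (2 * k) = even_skew_poly k" "skew_poly (Suc (2 * k)) = herm (of_real \<tau>) (2 * k + 1)"
      by (simp_all add: skew_poly_def)
    have "f \<noteq> 0" "u \<noteq> 0" using nz by (simp_all only: f_def u_def fact_nonzero not_False_eq_True)
    moreover have "symplectic_term p1 p2 k = x / (2 * u * f)"
      unfolding symplectic_term_def x_def u_def f_def ..
    ultimately have "r k * (u * ?h * f) = x / 2"
      using nz(1) by (simp add: r_def)
    moreover have "a (2 * k) (Suc (2 * k)) = u * ?h * f" "a (Suc (2 * k)) (2 * k) = - (u * ?h * f)"
      by (simp_all add: a_def skew_skew_poly u_def f_def algebra_simps del: fact_Suc)
    moreover have "b' (2 * k) (Suc (2 * k)) = x / 2" "b' (Suc (2 * k)) (2 * k) = - (x / 2)"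
      unfolding b'_def b_def qp x_def by (simp_all add: field_simps)
    ultimately show ?thesis using k by auto
  qed
  have I1: "(\<integral>z. \<phi> \<sigma> j z \<partial>lborel) = a (\<sigma> (2*j)) (\<sigma> (2*j+1))" for \<sigma> j
    unfolding \<phi> a_def skew_def omega_pairing_def[OF \<tau>] by (intro Bochner_Integration.integral_diff omega_pairing_integrable[OF \<tau>])
  have I2: "(\<integral>z. F z * \<phi> \<sigma> j z \<partial>lborel) = b (\<sigma> (2*j)) (\<sigma> (2*j+1))" for \<sigma> j
    unfolding F\<phi> b_def insertion_def omega_pairing_def[OF \<tau>] minus_diff_eq
    by (intro Bochner_Integration.integral_diff omega_pairing_integrable[OF \<tau>])
  let ?R = "\<lambda>\<sigma> j. \<Prod>i\<in>{..<n} - {j}. a (\<sigma> (2*i)) (\<sigma> (2*i+1))"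
  \<comment> \<open>The sum over j is moved outside because \<open>alternating_sum_swap\<close>
    treats a whole permutation sum at one fixed j; it returns inside for
    \<open>insertion_sum_pairs\<close>.\<close>
  have "(\<integral>z. (\<Sum>j<n. F (z j)) * complex_of_real (densH \<tau> n z) \<partial>confM n)
     = (\<Sum>j<n. \<Sum>\<sigma>\<in>?P. c \<sigma> * (b (\<sigma> (2*j)) (\<sigma> (2*j+1)) * ?R \<sigma> j))"
    unfolding opi(3) I1 I2 sum_distrib_left by (rule sum.swap)
  also have "\<dots> = (\<Sum>j<n. \<Sum>\<sigma>\<in>?P. c \<sigma> * (b' (\<sigma> (2*j)) (\<sigma> (2*j+1)) * ?R \<sigma> j))"
    unfolding c_def b'_def by (intro sum.cong refl alternating_sum_swap) simp
  also have "\<dots> = (\<Sum>\<sigma>\<in>?P. c \<sigma> * (\<Sum>j<n. b' (\<sigma> (2*j)) (\<sigma> (2*j+1)) * ?R \<sigma> j))"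
    unfolding sum_distrib_left by (rule sum.swap)
  also have "\<dots> = (\<Sum>\<sigma>\<in>?P. (\<Sum>k<n. r k) * (c \<sigma> * (\<Prod>i<n. a (\<sigma> (2*i)) (\<sigma> (2*i+1)))))"
  proof (intro sum.cong refl)
    fix \<sigma> assume "\<sigma> \<in> ?P"
    then have "\<sigma> permutes {..<2 * n}" by simp
    from insertion_sum_pairs[where b = b' and c = r, OF this a0 ab]
    show "c \<sigma> * (\<Sum>j<n. b' (\<sigma> (2*j)) (\<sigma> (2*j+1)) * ?R \<sigma> j)
      = (\<Sum>k<n. r k) * (c \<sigma> * (\<Prod>i<n. a (\<sigma> (2*i)) (\<sigma> (2*i+1))))"
      by (simp only: mult.left_commute)
  qed
  also have "\<dots> = (\<Sum>k<n. r k) * (\<integral>z. complex_of_real (densH \<tau> n z) \<partial>confM n)"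
    unfolding opi(2) sum_distrib_left I1 ..
  finally have num: "(\<integral>z. momentFn p1 p2 n z * complex_of_real (densH \<tau> n z) \<partial>confM n)
      = (\<Sum>k<n. r k) * (\<integral>z. complex_of_real (densH \<tau> n z) \<partial>confM n)"
    unfolding momentFn_def F_def .
  have "(\<integral>z. densH \<tau> n z \<partial>confM n) \<noteq> 0"
  proof (rule integral_density_nonzero)
    show "integrable (confM n) (densH \<tau> n)" using opi(1) by (simp only: complex_of_real_integrable_eq)
    show "densH \<tau> n z \<ge> 0" for z
      unfolding densH_def by (intro mult_nonneg_nonneg prod_nonneg ballI zero_le_power2 less_imp_le[OF omegaH_pos])
    fix z :: "nat \<Rightarrow> complex"
    assume z: "\<And>j. j < n \<Longrightarrow> 2 * real j < Re (z j) \<and> Re (z j) < 2 * real j + 1 \<and> Im (z j) > 0"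
    have 1: "z j \<noteq> z k \<and> z j \<noteq> cnj (z k)" if "j < k" "k < n" for j k
      using z[of j] z[of k] that by (auto simp: complex_eq_iff)
    have 2: "z j \<noteq> cnj (z j)" if "j < n" for j
      using z[of j] that by (auto simp: complex_eq_iff)
    show "densH \<tau> n z > 0"
      unfolding densH_def using 1 2 by (intro mult_pos_pos prod_pos ballI) (auto simp: omegaH_pos)
  qed
  then have "MH \<tau> p1 p2 n = (\<Sum>k<n. r k)"
    unfolding MH_def by (intro expect_eq num) simp
  then show ?thesis by (simp add: r_def sum_divide_distrib)
qed

section \<open>Assembly of the two formulas\<close>

lemma MC_formula:
  assumes "n \<ge> 1"
  shows "MC \<tau> p1 p2 n = complex_of_real (
              1 / (1 - \<tau>^2) * (1 / real (p1 + 1)) *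
              (\<Sum>m \<in> {int n - 1 - int (max (p1 + 1) p2) .. int n + int (max (p1 + 1) p2)}.
                  factZ m / fact (n - 1) *
                  (Acoef \<tau> (p1 + 1) m (int n - 1) * Acoef \<tau> p2 m (int n)
                   - \<tau> * Acoef \<tau> (p1 + 1) m (int n) * Acoef \<tau> p2 m (int n - 1))))"
proof -
  obtain N where N: "n = Suc N" using assms by (cases n) auto
  let ?h = "omega_pairing \<tau> 1 1" and ?t = "complex_of_real \<tau>"
  \<comment> \<open>The range covers the coefficient supports for both indices n - 1 and n, so it
    serves the two products alike.\<close>
  define lo where "lo = int n - 1 - int (max (p1 + 1) p2)"
  define hi where "hi = int n + int (max (p1 + 1) p2)"
  define X where "X = (\<Sum>m\<in>{lo..hi}. factZ m * (Acoef \<tau> (p1 + 1) m (int N) * Acoef \<tau> p2 m (int n)))"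
  define Y where "Y = (\<Sum>m\<in>{lo..hi}. factZ m * (Acoef \<tau> (p1 + 1) m (int n) * Acoef \<tau> p2 m (int N)))"
  have \<tau>2: "1 - \<tau>\<^sup>2 \<noteq> 0" using \<tau> by (auto simp: power2_eq_1_iff)
  have nz: "?h \<noteq> 0" by (rule omega_pairing_one_nonzero[OF \<tau>])
  have X: "omega_pairing \<tau> (monom 1 (Suc p1) * herm ?t N) (monom 1 p2 * herm ?t (Suc N)) = ?h * of_real X"
    unfolding X_def N Suc_eq_plus1[symmetric]
    by (rule pairing_Acoef[OF omega_pairing_hermite[OF \<tau>]]) (auto simp: lo_def hi_def N max_def)
  have Y: "omega_pairing \<tau> (monom 1 (Suc p1) * herm ?t (Suc N)) (monom 1 p2 * herm ?t N) = ?h * of_real Y"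
    unfolding Y_def N Suc_eq_plus1[symmetric]
    by (rule pairing_Acoef[OF omega_pairing_hermite[OF \<tau>]]) (auto simp: lo_def hi_def N max_def)
  define S where "S = (\<Sum>k<Suc N. omega_pairing \<tau> (monom 1 p1 * herm ?t k) (monom 1 p2 * herm ?t k) / fact k)"
  have "MC \<tau> p1 p2 n = S / ?h"
    unfolding MC_eq_sum N S_def sum_divide_distrib by (intro sum.cong refl) (simp add: mult.commute)
  moreover have e: "complex_of_real ((1 - \<tau>\<^sup>2) * real (Suc p1)) * S = ?h * of_real ((X - \<tau> * Y) / fact N)"
    using moment_telescope[of p1 p2 N] unfolding X Y S_def[symmetric]
    by (simp add: algebra_simps del: of_nat_Suc)
  moreover have c: "complex_of_real ((1 - \<tau>\<^sup>2) * real (Suc p1)) \<noteq> 0"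
    unfolding of_real_eq_0_iff using \<tau>2 by (simp del: of_nat_Suc)
  ultimately have "MC \<tau> p1 p2 n = of_real ((X - \<tau> * Y) / fact N) / complex_of_real ((1 - \<tau>\<^sup>2) * real (Suc p1))"
  proof -
    have "x = v / d" if "x = S / ?h" "d * S = ?h * v" "d \<noteq> 0" for x v d
    proof -
      have "d * x = (d * S) / ?h" using that(1) by simp
      also have "\<dots> = v" using that(2) nz by simp
      finally show ?thesis using that(3) by (simp add: field_simps)
    qed
    then show ?thesis using \<open>MC \<tau> p1 p2 n = S / ?h\<close> e c by blast
  qed
  also have "\<dots> = complex_of_real (1 / (1 - \<tau>^2) * (1 / real (p1 + 1)) * ((X - \<tau> * Y) / fact N))"
    unfolding of_real_divide[symmetric] by (simp del: of_nat_Suc)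
  also have "(X - \<tau> * Y) / fact N = (\<Sum>m \<in> {lo..hi}. factZ m / fact (n - 1) *
                  (Acoef \<tau> (p1 + 1) m (int n - 1) * Acoef \<tau> p2 m (int n)
                   - \<tau> * Acoef \<tau> (p1 + 1) m (int n) * Acoef \<tau> p2 m (int n - 1)))"
    unfolding X_def Y_def sum_distrib_left sum_subtractf[symmetric] sum_divide_distrib N
    by (intro sum.cong refl) (simp add: field_simps)
  finally show ?thesis unfolding lo_def hi_def .
qed

lemma MH_formula:
  assumes "p1 + p2 \<ge> 1"
  shows "MH \<tau> p1 p2 N =
              MC \<tau> p1 p2 (2 * N) / 2
              + (if p1 * p2 = 0 then 0
                 else complex_of_real ((1 - \<tau>^2) * (real (p1 * p2) / real (p1 + p2)))
                      * MH \<tau> (p1 - 1) (p2 - 1) N)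
              - complex_of_real (1 / 2 *
                 (\<Sum>k<N. \<Sum>n \<in> {2 * int N - int (max p1 p2) .. 2 * int N + int (max p1 p2)}.
                    factZ n / fact (2 * N) * ((2 ^ N * fact N) / (2 ^ k * fact k)) *
                    (real p1 / real (p1 + p2) * Acoef \<tau> p1 n (2 * int k) * Acoef \<tau> p2 n (2 * int N)
                     + real p2 / real (p1 + p2) * Acoef \<tau> p1 n (2 * int N) * Acoef \<tau> p2 n (2 * int k))))"
proof -
  let ?h = "omega_pairing \<tau> 1 1" and ?t = "complex_of_real \<tau>" and ?p = "herm (complex_of_real \<tau>)"
  define J where "J = {2 * int N - int (max p1 p2) .. 2 * int N + int (max p1 p2)}"
  define wt where "wt = (\<lambda>k. 2 ^ N * fact N / (2 ^ k * fact k) :: real)"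
  define X where "X = (\<lambda>k. \<Sum>n\<in>J. factZ n * (Acoef \<tau> p1 n (2 * int k) * Acoef \<tau> p2 n (2 * int N)))"
  define Y where "Y = (\<lambda>k. \<Sum>n\<in>J. factZ n * (Acoef \<tau> p1 n (2 * int N) * Acoef \<tau> p2 n (2 * int k)))"
  have nz: "?h \<noteq> 0" "?t \<noteq> 1" using omega_pairing_one_nonzero[OF \<tau>] \<tau> by simp_all
  have q: "even_skew_poly N - ?p (2 * N) = (\<Sum>k<N. smult (of_real (wt k)) (?p (2 * k)))"
    unfolding even_skew_poly_sum[symmetric] wt_def by simp
  have X: "omega_pairing \<tau> (monom 1 p1 * (even_skew_poly N - ?p (2 * N))) (monom 1 p2 * ?p (2 * N)) = ?h * of_real (\<Sum>k<N. wt k * X k)"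
  proof -
    have "omega_pairing \<tau> (monom 1 p1 * ?p (2 * k)) (monom 1 p2 * ?p (2 * N)) = ?h * of_real (X k)" for k
      using pairing_Acoef[OF omega_pairing_hermite[OF \<tau>], of "2 * int N - int (max p1 p2)" "2 * k" p1 "2 * int N + int (max p1 p2)" "2 * N" p2]
      unfolding X_def J_def by simp
    then show ?thesis unfolding q sum_distrib_left mult_smult_right sum_left smult_left
      by (simp add: sum_distrib_left mult_ac)
  qed
  have Y: "omega_pairing \<tau> (monom 1 p1 * ?p (2 * N)) (monom 1 p2 * (even_skew_poly N - ?p (2 * N))) = ?h * of_real (\<Sum>k<N. wt k * Y k)"
  proof -
    have "omega_pairing \<tau> (monom 1 p1 * ?p (2 * N)) (monom 1 p2 * ?p (2 * k)) = ?h * of_real (Y k)" for k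
      using pairing_Acoef[OF omega_pairing_hermite[OF \<tau>], of "2 * int N - int (max p1 p2)" "2 * N" p1 "2 * int N + int (max p1 p2)" "2 * k" p2]
      unfolding Y_def J_def by simp
    then show ?thesis unfolding q sum_distrib_left mult_smult_right sum_right smult_right
      by (simp add: sum_distrib_left mult_ac)
  qed
  \<comment> \<open>The telescoped identity carries the factor p1 + p2; the hypothesis allows the
    division by it.\<close>
  define s where "s = real (p1 + p2)"
  have s: "s \<noteq> 0" using assms by (simp add: s_def)
  define Z where "Z = (real p1 * (\<Sum>k<N. wt k * X k) + real p2 * (\<Sum>k<N. wt k * Y k)) / (2 * fact (2 * N))"
  define mc where "mc = MC \<tau> p1 p2 (2 * N)"
  define mh where "mh = MH \<tau> (p1 - 1) (p2 - 1) N"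
  have mc: "mc * ?h = (\<Sum>n<2*N. omega_pairing \<tau> (monom 1 p1 * ?p n) (monom 1 p2 * ?p n) / fact n)"
    unfolding mc_def MC_eq_sum sum_distrib_right using nz by (intro sum.cong refl) simp
  have mh: "mh * ?h = (\<Sum>k<N. symplectic_term (p1 - 1) (p2 - 1) k)"
    unfolding mh_def MH_eq_sum using nz by simp
  have MHh: "MH \<tau> p1 p2 N * ?h = (\<Sum>k<N. symplectic_term p1 p2 k)"
    unfolding MH_eq_sum using nz by simp
  have "of_real s * (MH \<tau> p1 p2 N * ?h) = of_real s / 2 * (mc * ?h)
      + of_real ((1 - \<tau>\<^sup>2) * real (p1 * p2)) * (mh * ?h) - ?h * of_real Z"
    using symplectic_term_telescope[OF nz(2), of p1 p2 N] unfolding X Y mc[symmetric] mh[symmetric] MHh[symmetric]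
    by (simp add: s_def Z_def algebra_simps add_divide_distrib)
  then have "?h * (of_real s * MH \<tau> p1 p2 N) = ?h * (of_real s / 2 * mc
      + of_real ((1 - \<tau>\<^sup>2) * real (p1 * p2)) * mh - of_real Z)"
    by (simp only: distrib_left right_diff_distrib mult_ac)
  then have m: "of_real s * MH \<tau> p1 p2 N = of_real s / 2 * mc
      + of_real ((1 - \<tau>\<^sup>2) * real (p1 * p2)) * mh - of_real Z"
    using nz by (simp only: mult_cancel_left) simp
  have "MH \<tau> p1 p2 N = (of_real s * MH \<tau> p1 p2 N) / of_real s" using s by simp
  also have "\<dots> = mc / 2 + of_real ((1 - \<tau>\<^sup>2) * real (p1 * p2)) * mh / of_real s - of_real Z / of_real s"
    unfolding m add_divide_distrib diff_divide_distrib using s by simp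
  \<comment> \<open>For p1 p2 = 0 the truncated exponents in \<open>mh\<close> are harmless, as
    their coefficient is 0.\<close>
  also have "of_real ((1 - \<tau>\<^sup>2) * real (p1 * p2)) * mh / of_real s
      = (if p1 * p2 = 0 then 0 else complex_of_real ((1 - \<tau>^2) * (real (p1 * p2) / real (p1 + p2))) * mh)"
    by (simp add: s_def)
  also have "of_real Z / of_real s = complex_of_real (1 / 2 *
                 (\<Sum>k<N. \<Sum>n \<in> J. factZ n / fact (2 * N) * wt k *
                    (real p1 / s * Acoef \<tau> p1 n (2 * int k) * Acoef \<tau> p2 n (2 * int N)
                     + real p2 / s * Acoef \<tau> p1 n (2 * int N) * Acoef \<tau> p2 n (2 * int k))))"
  proof -
    have "(\<Sum>n \<in> J. factZ n / fact (2 * N) * wt k *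
                    (real p1 / s * Acoef \<tau> p1 n (2 * int k) * Acoef \<tau> p2 n (2 * int N)
                     + real p2 / s * Acoef \<tau> p1 n (2 * int N) * Acoef \<tau> p2 n (2 * int k)))
        = (real p1 * (wt k * X k) + real p2 * (wt k * Y k)) / (fact (2 * N) * s)" for k
      unfolding X_def Y_def sum_distrib_left sum.distrib[symmetric] sum_divide_distrib using s
      by (intro sum.cong refl) (simp add: field_simps)
    then have "1 / 2 * (\<Sum>k<N. \<Sum>n \<in> J. factZ n / fact (2 * N) * wt k *
                    (real p1 / s * Acoef \<tau> p1 n (2 * int k) * Acoef \<tau> p2 n (2 * int N)
                     + real p2 / s * Acoef \<tau> p1 n (2 * int N) * Acoef \<tau> p2 n (2 * int k)))
        = 1 / 2 * ((real p1 * (\<Sum>k<N. wt k * X k) + real p2 * (\<Sum>k<N. wt k * Y k)) / (fact (2 * N) * s))"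
      by (simp only:) (simp only: sum_distrib_left sum.distrib[symmetric] sum_divide_distrib)
    also have "\<dots> = Z / s" by (simp add: Z_def)
    finally show ?thesis by simp
  qed
  finally show ?thesis unfolding mc_def mh_def J_def wt_def s_def .
qed

end

theorem mainTheorem7:
  fixes \<tau> :: real and N :: nat
  assumes "0 \<le> \<tau>" and "\<tau> < 1" and "N \<ge> 1"
  shows "(\<forall>p1 p2 :: nat.
            MC \<tau> p1 p2 N = complex_of_real (
              1 / (1 - \<tau>^2) * (1 / real (p1 + 1)) *
              (\<Sum>n \<in> {int N - 1 - int (max (p1 + 1) p2) .. int N + int (max (p1 + 1) p2)}.
                  factZ n / fact (N - 1) *
                  (Acoef \<tau> (p1 + 1) n (int N - 1) * Acoef \<tau> p2 n (int N)
                   - \<tau> * Acoef \<tau> (p1 + 1) n (int N) * Acoef \<tau> p2 n (int N - 1)))))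
       \<and> (\<forall>p1 p2 :: nat. p1 + p2 \<ge> 1 \<longrightarrow>
            MH \<tau> p1 p2 N =
              MC \<tau> p1 p2 (2 * N) / 2
              + (if p1 * p2 = 0 then 0
                 else complex_of_real ((1 - \<tau>^2) * (real (p1 * p2) / real (p1 + p2)))
                      * MH \<tau> (p1 - 1) (p2 - 1) N)
              - complex_of_real (1 / 2 *
                 (\<Sum>k<N. \<Sum>n \<in> {2 * int N - int (max p1 p2) .. 2 * int N + int (max p1 p2)}.
                    factZ n / fact (2 * N) * ((2 ^ N * fact N) / (2 ^ k * fact k)) *
                    (real p1 / real (p1 + p2) * Acoef \<tau> p1 n (2 * int k) * Acoef \<tau> p2 n (2 * int N)
                     + real p2 / real (p1 + p2) * Acoef \<tau> p1 n (2 * int N) * Acoef \<tau> p2 n (2 * int k)))))"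
proof -
  have "-1 < \<tau>" using assms by simp
  then show ?thesis
    using MC_formula[of \<tau> N] MH_formula[of \<tau>] assms by blast
qed

end
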